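(* Let $U$ be a graph that contains every planar graph. Then (a) the countably infinite complete graph $K_{\aleph_0}$ is a minor of $U$, and (b) $U$ contains a subdivision of $K_t$ for every $t\in\mathbb{N}$.
   Context: All graphs are simple and countable (finite or countably infinite); in particular "every planar graph" means every countable planar graph. A graph $G$ contains a graph $H$ if $H$ is isomorphic to a subgraph of $G$. *)

theory Defs
  imports "HOL-Analysis.Analysis"
begin

definition simple_graph :: "'a set \<Rightarrow> ('a \<Rightarrow> 'a \<Rightarrow> bool) \<Rightarrow> bool" where
  "simple_graph V E \<longleftrightarrow>
     (\<forall>x y. E x y \<longrightarrow> x \<in> V \<and> y \<in> V) \<and> (\<forall>x y. E x y \<longrightarrow> E y x) \<and> (\<forall>x. \<not> E x x)"

definition graph_contains :: "'a set \<Rightarrow> ('a \<Rightarrow> 'a \<Rightarrow> bool) \<Rightarrow> 'b set \<Rightarrow> ('b \<Rightarrow> 'b \<Rightarrow> bool) \<Rightarrow> bool" where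
  "graph_contains V E W F \<longleftrightarrow>
     (\<exists>f. inj_on f W \<and> f ` W \<subseteq> V \<and> (\<forall>x\<in>W. \<forall>y\<in>W. F x y \<longrightarrow> E (f x) (f y)))"

definition planar :: "'b set \<Rightarrow> ('b \<Rightarrow> 'b \<Rightarrow> bool) \<Rightarrow> bool" where
  "planar W F \<longleftrightarrow>
     (\<exists>(p :: 'b \<Rightarrow> complex) (\<gamma> :: 'b \<Rightarrow> 'b \<Rightarrow> real \<Rightarrow> complex).
        inj_on p W \<and>
        (\<forall>x y. F x y \<longrightarrow> arc (\<gamma> x y) \<and> pathstart (\<gamma> x y) = p x \<and> pathfinish (\<gamma> x y) = p y \<and>
                 (\<forall>w\<in>W. w \<noteq> x \<and> w \<noteq> y \<longrightarrow> p w \<notin> path_image (\<gamma> x y))) \<and>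
        (\<forall>x y u v. F x y \<and> F u v \<and> {x, y} \<noteq> {u, v} \<longrightarrow>
                 path_image (\<gamma> x y) \<inter> path_image (\<gamma> u v) \<subseteq> p ` ({x, y} \<inter> {u, v})))"

definition graph_path :: "('a \<Rightarrow> 'a \<Rightarrow> bool) \<Rightarrow> 'a list \<Rightarrow> bool" where
  "graph_path E xs \<longleftrightarrow> xs \<noteq> [] \<and> distinct xs \<and> (\<forall>i. Suc i < length xs \<longrightarrow> E (xs ! i) (xs ! Suc i))"

definition connected_set :: "('a \<Rightarrow> 'a \<Rightarrow> bool) \<Rightarrow> 'a set \<Rightarrow> bool" where
  "connected_set E S \<longleftrightarrow>
     (\<forall>x\<in>S. \<forall>y\<in>S. \<exists>xs. graph_path E xs \<and> hd xs = x \<and> last xs = y \<and> set xs \<subseteq> S)"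

definition has_K_aleph0_minor :: "'a set \<Rightarrow> ('a \<Rightarrow> 'a \<Rightarrow> bool) \<Rightarrow> bool" where
  "has_K_aleph0_minor V E \<longleftrightarrow>
     (\<exists>B :: nat \<Rightarrow> 'a set.
        (\<forall>i. B i \<noteq> {} \<and> B i \<subseteq> V \<and> connected_set E (B i)) \<and>
        (\<forall>i j. i \<noteq> j \<longrightarrow> B i \<inter> B j = {}) \<and>
        (\<forall>i j. i \<noteq> j \<longrightarrow> (\<exists>x\<in>B i. \<exists>y\<in>B j. E x y)))"

definition has_subdivided_K :: "'a set \<Rightarrow> ('a \<Rightarrow> 'a \<Rightarrow> bool) \<Rightarrow> nat \<Rightarrow> bool" where
  "has_subdivided_K V E t \<longleftrightarrow>
     (\<exists>(b :: nat \<Rightarrow> 'a) (P :: nat \<Rightarrow> nat \<Rightarrow> 'a list).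
        inj_on b {..<t} \<and> b ` {..<t} \<subseteq> V \<and>
        (\<forall>i j. i < j \<and> j < t \<longrightarrow>
           graph_path E (P i j) \<and> hd (P i j) = b i \<and> last (P i j) = b j \<and>
           set (P i j) \<subseteq> V \<and> set (P i j) \<inter> b ` {..<t} = {b i, b j}) \<and>
        (\<forall>i j k l. i < j \<and> j < t \<and> k < l \<and> l < t \<and> (i, j) \<noteq> (k, l) \<longrightarrow>
           set (P i j) \<inter> set (P k l) \<subseteq> b ` {..<t}))"

end

theory Submission
  imports Defs
begin

text \<open>
  Consider the quarter-plane grid in which every unit square has one diagonal, and let an arbitrary
  sequence \<open>A\<close> of bits decide which of the two diagonals is present in the squares of column \<open>x\<close>
  lying in every fourth row. All these uncountably many planar graphs embed into the countable graph
  \<open>U\<close>, so one of the embeddings, \<open>f\<close>, is an accumulation point: for every finite set there is an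
  embedding \<open>g\<close> of a lattice with a different bit sequence which agrees with \<open>f\<close> there. As a
  triangulation extends rigidly from a finite part, \<open>g\<close> can differ from the lattice \<open>f\<close> only by using a
  detour: a short path of \<open>U\<close> that avoids the lattice locally and joins two nearby non-adjacent lattice
  vertices. Detours are found arbitrarily far out, at any prescribed height, and disjoint from
  whatever was built before. In the lattice, a detour lets two neighbouring rails running to the
  right exchange their positions. Exchanging rails repeatedly makes any two of them adjacent at
  some time, which gives the minor; starting the rails at \<open>t\<close> vertices of degree \<open>t\<close> to the left of the
  grid gives the subdivision.
\<close>

subsection \<open>The planar graphs\<close>

text \<open>Agreement of \<open>f\<close> and \<open>g\<close> can spread only where both lattices
  have the same diagonals. Hence the bits occur in every fourth row only: the four rows
  \<open>S..S + 3\<close> in between form a strip that forces itself column by column, and a bit is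
  read off between two such strips. Wherever the forcing fails, a path of \<open>g\<close> with at
  most two departing vertices returns to agreement at a non-neighbour, so a detour has at most two
  inner vertices. The obstacle is that \<open>g\<close> may use lattice vertices of \<open>f\<close>
  far away, so a detour can meet the lattice in places that cannot be controlled. Three devices deal
  with this. Inside a box around its ends the detour avoids \<open>f\<close>. Outside, it meets at
  most two rows, so one of any three consecutive rows is free for a rail. Finally, vertices used
  earlier are avoided: those in the lattice because \<open>g\<close> agrees with \<open>f\<close> on
  a large square, those off the lattice because the accumulation also controls which vertices of a
  finite set are used at all.\<close>

definition anti :: "(nat \<Rightarrow> bool) \<Rightarrow> nat \<Rightarrow> nat \<Rightarrow> bool" where
  "anti A x y \<longleftrightarrow> y mod 4 = 3 \<and> A x"

text \<open>Column 0 consists of hubs: hub \<open>j\<close> is joined to the \<open>t\<close> vertices of column 1 in the rows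
  \<open>j * t, \<dots>, j * t + t - 1\<close>. The grid occupies the columns from 1 on.\<close>
definition fwd :: "nat \<Rightarrow> (nat \<Rightarrow> bool) \<Rightarrow> nat \<times> nat \<Rightarrow> nat \<times> nat \<Rightarrow> bool" where
  "fwd t A p q \<longleftrightarrow>
     fst p = 0 \<and> fst q = 1 \<and> snd q div t = snd p \<or>
     0 < fst p \<and> fst q = fst p \<and> snd q = Suc (snd p) \<or>
     0 < fst p \<and> fst q = Suc (fst p) \<and>
       (snd q = snd p \<or>
        snd q = Suc (snd p) \<and> \<not> anti A (fst p) (snd p) \<or>
        snd p = Suc (snd q) \<and> anti A (fst p) (snd q))"

definition adj :: "nat \<Rightarrow> (nat \<Rightarrow> bool) \<Rightarrow> nat \<times> nat \<Rightarrow> nat \<times> nat \<Rightarrow> bool" where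
  "adj t A p q \<longleftrightarrow> fwd t A p q \<or> fwd t A q p"

definition pos :: "nat \<times> nat \<Rightarrow> complex" where
  "pos p = Complex (real (fst p)) (real (snd p))"

lemma pos_eq_iff [simp]: "pos p = pos q \<longleftrightarrow> p = q"
  by (auto simp: pos_def prod_eq_iff)

section \<open>Straight-line drawing of the lattice without crossings\<close>

lemma nat_plus_fraction:
  assumes "real m = real n + s" and "0 \<le> s" and "s \<le> 1"
  shows "m = n \<and> s = 0 \<or> m = Suc n \<and> s = 1"
proof -
  have "real n \<le> real m" "real m \<le> real (Suc n)"
    using assms by simp_all
  then have "m = n \<or> m = Suc n"
    unfolding of_nat_le_iff by linarith
  then show ?thesis
    using assms(1) by auto
qed

lemma segment_fwd:
  assumes "fwd t A p q" and "z \<in> closed_segment (pos p) (pos q)"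
  obtains (vertical) "fst q = fst p" "snd q = Suc (snd p)"
      "Re z = real (fst p)" "real (snd p) \<le> Im z" "Im z \<le> real (snd p) + 1"
  | (across) s where "fst q = Suc (fst p)" "0 \<le> s" "s \<le> 1"
      "Re z = real (fst p) + s" "Im z = (1 - s) * real (snd p) + s * real (snd q)"
proof -
  from assms(2) obtain s where s: "0 \<le> s" "s \<le> 1" "z = (1 - s) *\<^sub>R pos p + s *\<^sub>R pos q"
    by (auto simp: closed_segment_def)
  have re: "Re z = (1 - s) * real (fst p) + s * real (fst q)"
    and im: "Im z = (1 - s) * real (snd p) + s * real (snd q)"
    by (simp_all add: s(3) pos_def)
  show thesis
  proof (cases "fst q = fst p")
    case True
    then have q: "snd q = Suc (snd p)"
      using assms(1) by (auto simp: fwd_def)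
    show ?thesis
      using vertical True q s(1,2) re im by (simp add: algebra_simps)
  next
    case False
    then have q: "fst q = Suc (fst p)"
      using assms(1) by (auto simp: fwd_def)
    show ?thesis
      using across q s(1,2) re im by (simp add: algebra_simps)
  qed
qed

lemma lattice_point_on_segment:
  assumes "fwd t A p q" and "pos w \<in> closed_segment (pos p) (pos q)"
  shows "w = p \<or> w = q"
  using assms
proof (cases rule: segment_fwd)
  case vertical
  then have "snd w = snd p \<or> snd w = Suc (snd p)"
    using nat_plus_fraction[of "snd w" "snd p" "Im (pos w) - real (snd p)"] by (auto simp: pos_def)
  with vertical show ?thesis
    by (auto simp: pos_def prod_eq_iff)
next
  case (across s)
  then have "real (fst w) = real (fst p) + s"
    by (simp add: pos_def)
  then have "fst w = fst p \<and> s = 0 \<or> fst w = Suc (fst p) \<and> s = 1"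
    using nat_plus_fraction across(2,3) by blast
  with across show ?thesis
    by (auto simp: pos_def prod_eq_iff)
qed

text \<open>Inside the grid, only the two diagonals of one square could reverse their order, and
  \<open>anti\<close> selects exactly one of them. At column 0 the order is kept because
  \<open>div\<close> is monotone, also for \<open>t = 0\<close>, where \<open>y div 0 = 0\<close>
  joins hub 0 to the whole of column 1.\<close>

lemma fwd_monotone:
  assumes "fwd t A p q" and "fwd t A p' q'" and "fst p = fst p'"
    and "fst q = Suc (fst p)" and "fst q' = Suc (fst p)"
  shows "snd p \<le> snd p' \<and> snd q \<le> snd q' \<or> snd p' \<le> snd p \<and> snd q' \<le> snd q"
proof (cases "fst p = 0")
  case True
  then have d: "snd p = snd q div t" "snd p' = snd q' div t"
    using assms(1-3) by (simp_all add: fwd_def)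
  show ?thesis
    unfolding d using nat_le_linear[of "snd q" "snd q'"] by (auto intro: div_le_mono)
next
  case False
  have crossing: False
    if "a < b" "b' < a'"
      "a' = a \<or> a' = Suc a \<and> \<not> P a \<or> a = Suc a' \<and> P a'"
      "b' = b \<or> b' = Suc b \<and> \<not> P b \<or> b = Suc b' \<and> P b'"
    for a b a' b' :: nat and P
  proof -
    have "a' = Suc a" "b' = a" "b = Suc a"
      using that by linarith+
    then show False
      using that by simp
  qed
  have *: "snd q = snd p \<or> snd q = Suc (snd p) \<and> \<not> anti A (fst p) (snd p) \<or> snd p = Suc (snd q) \<and> anti A (fst p) (snd q)"
    and **: "snd q' = snd p' \<or> snd q' = Suc (snd p') \<and> \<not> anti A (fst p) (snd p') \<or> snd p' = Suc (snd q') \<and> anti A (fst p) (snd q')"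
    using assms False by (auto simp: fwd_def)
  have "\<not> (snd p < snd p' \<and> snd q' < snd q)" "\<not> (snd p' < snd p \<and> snd q < snd q')"
    using crossing[OF _ _ * **] crossing[OF _ _ ** *] by blast+
  then show ?thesis
    by linarith
qed

lemma fwd_segments_meet:
  assumes e: "fwd t A p q" and e': "fwd t A p' q'" and ne: "(p, q) \<noteq> (p', q')"
    and z: "z \<in> closed_segment (pos p) (pos q)" and z': "z \<in> closed_segment (pos p') (pos q')"
  shows "z \<in> pos ` ({p, q} \<inter> {p', q'})"
proof -
  have lattice: ?thesis if "z = pos w" for w
    using lattice_point_on_segment[OF e] lattice_point_on_segment[OF e'] z z' that by blast
  show ?thesis
    using e z
  proof (cases rule: segment_fwd)
    case v: vertical
    show ?thesis
      using e' z'
    proof (cases rule: segment_fwd)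
      case v': vertical
      have "fst p = fst p'"
        using v v' by simp
      then have "snd p \<noteq> snd p'"
        using ne v v' by (auto simp: prod_eq_iff)
      then consider "snd p' = Suc (snd p)" "Im z = real (snd p')" | "snd p = Suc (snd p')" "Im z = real (snd p)"
        using v(4,5) v'(4,5) by linarith
      then show ?thesis
      proof cases
        case 1
        then show ?thesis
          using v' by (intro lattice[of p']) (simp add: pos_def complex_eq_iff)
      next
        case 2
        then show ?thesis
          using v by (intro lattice[of p]) (simp add: pos_def complex_eq_iff)
      qed
    next
      case (across s)
      then have "s = 0 \<or> s = 1"
        using v(3) nat_plus_fraction[of "fst p" "fst p'" s] by auto
      then show ?thesis
      proof
        assume "s = 0"
        with across show ?thesis
          by (intro lattice[of p']) (simp add: pos_def complex_eq_iff)
      next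
        assume "s = 1"
        with across show ?thesis
          by (intro lattice[of q']) (simp add: pos_def complex_eq_iff)
      qed
    qed
  next
    case (across s)
    have ends: ?thesis if "s = 0 \<or> s = 1"
      using that
    proof
      assume "s = 0"
      with across show ?thesis
        by (intro lattice[of p]) (simp add: pos_def complex_eq_iff)
    next
      assume "s = 1"
      with across show ?thesis
        by (intro lattice[of q]) (simp add: pos_def complex_eq_iff)
    qed
    show ?thesis
      using e' z'
    proof (cases rule: segment_fwd)
      case vertical
      then have "s = 0 \<or> s = 1"
        using across nat_plus_fraction[of "fst p'" "fst p" s] by auto
      then show ?thesis
        by (rule ends)
    next
      case s': (across s')
      show ?thesis
      proof (cases "fst p = fst p'")
        case False
        then consider "fst p < fst p'" | "fst p' < fst p"
          by linarith
        then have "s = 0 \<or> s = 1"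
        proof cases
          case 1
          then have "real (fst p) + 1 \<le> real (fst p')"
            by linarith
          then show ?thesis
            using across s' by linarith
        next
          case 2
          then have "real (fst p') + 1 \<le> real (fst p)"
            by linarith
          then show ?thesis
            using across s' by linarith
        qed
        then show ?thesis
          by (rule ends)
      next
        case True
        then have "s' = s"
          using across s' by simp
        \<comment> \<open>At offset \<open>s\<close> the heights of the two edges differ by a
          weighted mean of the differences at both ends. By \<open>fwd_monotone\<close> these do not
          have opposite signs, so both terms vanish; as the edges differ, \<open>s\<close> is 0 or
          1.\<close>
        then have 0: "(1 - s) * (real (snd p') - real (snd p)) + s * (real (snd q') - real (snd q)) = 0"
          using across s' by (simp add: algebra_simps)
        have "snd p \<noteq> snd p' \<or> snd q \<noteq> snd q'"
          using ne True across s' by (auto simp: prod_eq_iff)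
        moreover have "snd p \<le> snd p' \<and> snd q \<le> snd q' \<or> snd p' \<le> snd p \<and> snd q' \<le> snd q"
          using fwd_monotone[OF e e' True] across s' True by simp
        then have "(1 - s) * (real (snd p') - real (snd p)) = 0 \<and> s * (real (snd q') - real (snd q)) = 0"
        proof
          assume "snd p \<le> snd p' \<and> snd q \<le> snd q'"
          then have "0 \<le> (1 - s) * (real (snd p') - real (snd p))" "0 \<le> s * (real (snd q') - real (snd q))"
            using across by simp_all
          with 0 show ?thesis
            by linarith
        next
          assume "snd p' \<le> snd p \<and> snd q' \<le> snd q"
          then have "(1 - s) * (real (snd p') - real (snd p)) \<le> 0" "s * (real (snd q') - real (snd q)) \<le> 0"
            using across by (simp_all add: mult_nonneg_nonpos)
          with 0 show ?thesis
            by linarith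
        qed
        ultimately have "s = 0 \<or> s = 1"
          by auto
        then show ?thesis
          by (rule ends)
      qed
    qed
  qed
qed

lemma fwd_irrefl: "\<not> fwd t A p p"
  by (auto simp: fwd_def)

lemma simple_graph_adj: "simple_graph UNIV (\<lambda>m n. adj t A (prod_decode m) (prod_decode n))"
  by (auto simp: simple_graph_def adj_def fwd_irrefl)

lemma planar_adj: "planar UNIV (\<lambda>m n. adj t A (prod_decode m) (prod_decode n))"
  unfolding planar_def
proof (intro exI conjI allI impI)
  let ?p = "\<lambda>n. pos (prod_decode n)"
  let ?\<gamma> = "\<lambda>m n. linepath (?p m) (?p n)"
  have dec: "prod_decode m = prod_decode n \<longleftrightarrow> m = n" for m n
    by (metis prod_decode_inverse)
  show "inj_on ?p UNIV"
    by (auto simp: inj_on_def dec)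
  fix x y
  {
    assume a: "adj t A (prod_decode x) (prod_decode y)"
    then have "prod_decode x \<noteq> prod_decode y"
      by (auto simp: adj_def fwd_irrefl)
    then show "arc (?\<gamma> x y)" "pathstart (?\<gamma> x y) = ?p x" "pathfinish (?\<gamma> x y) = ?p y"
      by (simp_all add: arc_linepath)
    show "\<forall>w\<in>UNIV. w \<noteq> x \<and> w \<noteq> y \<longrightarrow> ?p w \<notin> path_image (?\<gamma> x y)"
    proof (intro ballI impI notI)
      fix w
      assume "w \<noteq> x \<and> w \<noteq> y" "?p w \<in> path_image (?\<gamma> x y)"
      then show False
        using a lattice_point_on_segment[of t A "prod_decode x" "prod_decode y" "prod_decode w"]
          lattice_point_on_segment[of t A "prod_decode y" "prod_decode x" "prod_decode w"]
          closed_segment_commute[of "?p x" "?p y"]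
        unfolding adj_def dec path_image_linepath by blast
    qed
  }
  fix u v
  assume a: "adj t A (prod_decode x) (prod_decode y) \<and> adj t A (prod_decode u) (prod_decode v) \<and> {x, y} \<noteq> {u, v}"
  show "path_image (?\<gamma> x y) \<inter> path_image (?\<gamma> u v) \<subseteq> ?p ` ({x, y} \<inter> {u, v})"
  proof
    fix z
    assume z: "z \<in> path_image (?\<gamma> x y) \<inter> path_image (?\<gamma> u v)"
    have oriented: "\<exists>m' n'. {m', n'} = {m, n} \<and> fwd t A (prod_decode m') (prod_decode n') \<and>
        z \<in> closed_segment (?p m') (?p n')"
      if "adj t A (prod_decode m) (prod_decode n)" "z \<in> path_image (?\<gamma> m n)" for m n
    proof (cases "fwd t A (prod_decode m) (prod_decode n)")
      case True
      with that(2) show ?thesis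
        by (intro exI[of _ m] exI[of _ n]) simp
    next
      case False
      with that show ?thesis
        by (intro exI[of _ n] exI[of _ m]) (simp add: adj_def closed_segment_commute insert_commute)
    qed
    obtain x' y' where xy: "{x', y'} = {x, y}" "fwd t A (prod_decode x') (prod_decode y')"
      "z \<in> closed_segment (?p x') (?p y')"
      using oriented[of x y] a z by blast
    obtain u' v' where uv: "{u', v'} = {u, v}" "fwd t A (prod_decode u') (prod_decode v')"
      "z \<in> closed_segment (?p u') (?p v')"
      using oriented[of u v] a z by blast
    have "(prod_decode x', prod_decode y') \<noteq> (prod_decode u', prod_decode v')"
      using a xy(1) uv(1) by (auto simp: dec)
    from fwd_segments_meet[OF xy(2) uv(2) this xy(3) uv(3)]
    have "z \<in> ?p ` ({x', y'} \<inter> {u', v'})"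
      by (auto simp: dec)
    then show "z \<in> ?p ` ({x, y} \<inter> {u, v})"
      by (simp add: xy uv)
  qed
qed

subsection \<open>An accumulation point among the embeddings\<close>

text \<open>Otherwise each \<open>a\<close> would be determined by a number \<open>n a\<close> and
  its first \<open>n a\<close> values, which are countably many data.\<close>

lemma condensation_point:
  fixes \<phi> :: "nat \<Rightarrow> 'b \<Rightarrow> 'c :: countable"
  assumes "uncountable (UNIV :: 'b set)"
  shows "\<exists>a. \<forall>n. \<exists>b. b \<noteq> a \<and> (\<forall>j<n. \<phi> j b = \<phi> j a)"
proof (rule ccontr)
  assume "\<not> ?thesis"
  then obtain n where n: "\<And>a b. b \<noteq> a \<Longrightarrow> \<exists>j<n a. \<phi> j b \<noteq> \<phi> j a"
    by metis
  have "inj (\<lambda>a. (n a, map (\<lambda>j. \<phi> j a) [0..<n a]))"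
  proof (rule injI)
    fix a b
    assume eq: "(n a, map (\<lambda>j. \<phi> j a) [0..<n a]) = (n b, map (\<lambda>j. \<phi> j b) [0..<n b])"
    from arg_cong[OF this, of fst] have nn: "n b = n a"
      by simp
    from arg_cong[OF eq, of snd] have "\<forall>j<n a. \<phi> j b = \<phi> j a"
      unfolding nn snd_conv map_eq_conv by simp
    then show "a = b"
      using n[of b a] by blast
  qed
  then have "countable (UNIV :: 'b set)"
    by (rule countableI')
  with assms show False
    by simp
qed

lemma uncountable_predicates: "uncountable (UNIV :: (nat \<Rightarrow> bool) set)"
proof
  assume count: "countable (UNIV :: (nat \<Rightarrow> bool) set)"
  have "(\<lambda>m. \<not> from_nat_into (UNIV :: (nat \<Rightarrow> bool) set) m m) \<in> range (from_nat_into UNIV)"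
    unfolding range_from_nat_into[OF UNIV_not_empty count] by (rule UNIV_I)
  then obtain n where "(\<lambda>m. \<not> from_nat_into (UNIV :: (nat \<Rightarrow> bool) set) m m) = from_nat_into UNIV n"
    by (rule imageE)
  from fun_cong[OF this, of n] show False
    by blast
qed

lemma accumulating_embedding:
  assumes "simple_graph V E" and "countable V"
    and univ: "\<forall>(W :: nat set) F. simple_graph W F \<and> planar W F \<longrightarrow> graph_contains V E W F"
  obtains A f where "inj f" "range f \<subseteq> V" "\<And>p q. adj t A p q \<Longrightarrow> E (f p) (f q)"
    "\<And>n Z. finite Z \<Longrightarrow> \<exists>B g. B \<noteq> A \<and> (\<forall>x\<le>n. B x = A x) \<and> inj g \<and> range g \<subseteq> V \<and>
       (\<forall>p q. adj t B p q \<longrightarrow> E (g p) (g q)) \<and>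
       (\<forall>x\<le>n. \<forall>y\<le>n. g (x, y) = f (x, y)) \<and> range g \<inter> Z \<subseteq> range f"
proof -
  have "\<forall>A. \<exists>f. inj f \<and> range f \<subseteq> V \<and> (\<forall>p q. adj t A p q \<longrightarrow> E (f p) (f q))"
  proof
    fix A
    have "graph_contains V E UNIV (\<lambda>m n. adj t A (prod_decode m) (prod_decode n))"
      using univ simple_graph_adj[of t A] planar_adj[of t A] by blast
    then obtain h where h: "inj h" "range h \<subseteq> V"
      "\<And>m n. adj t A (prod_decode m) (prod_decode n) \<Longrightarrow> E (h m) (h n)"
      unfolding graph_contains_def by blast
    show "\<exists>f. inj f \<and> range f \<subseteq> V \<and> (\<forall>p q. adj t A p q \<longrightarrow> E (f p) (f q))"
    proof (intro exI[of _ "h \<circ> prod_encode"] conjI allI impI)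
      show "inj (h \<circ> prod_encode)"
        using h(1) inj_prod_encode by (rule inj_compose)
      show "range (h \<circ> prod_encode) \<subseteq> V"
        using h(2) by auto
      show "E ((h \<circ> prod_encode) p) ((h \<circ> prod_encode) q)" if "adj t A p q" for p q
        using that h(3)[of "prod_encode p" "prod_encode q"] by simp
    qed
  qed
  from choice[OF this] obtain F where F: "\<And>A. inj (F A)" "\<And>A. range (F A) \<subseteq> V"
    "\<And>A p q. adj t A p q \<Longrightarrow> E (F A p) (F A q)"
    by blast
  \<comment> \<open>Three facts are recorded: the image of the \<open>j\<close>-th lattice point,
    the \<open>j\<close>-th bit, and whether the \<open>j\<close>-th vertex of \<open>V\<close> lies
    in the image. The last one yields \<open>range g \<inter> Z \<subseteq> range f\<close>.\<close>
  define \<phi> where "\<phi> j A = (to_nat_on V (F A (prod_decode j)), A j, from_nat_into V j \<in> range (F A))" for j A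
  obtain A where A: "\<And>n. \<exists>B. B \<noteq> A \<and> (\<forall>j<n. \<phi> j B = \<phi> j A)"
    using condensation_point[OF uncountable_predicates, of \<phi>] by blast
  show thesis
  proof (rule that[of "F A" A])
    show "\<exists>B g. B \<noteq> A \<and> (\<forall>x\<le>n. B x = A x) \<and> inj g \<and> range g \<subseteq> V \<and>
       (\<forall>p q. adj t B p q \<longrightarrow> E (g p) (g q)) \<and>
       (\<forall>x\<le>n. \<forall>y\<le>n. g (x, y) = F A (x, y)) \<and> range g \<inter> Z \<subseteq> range (F A)"
      if "finite Z" for n Z
    proof -
      have "finite ({..n} \<union> prod_encode ` ({..n} \<times> {..n}) \<union> to_nat_on V ` Z)"
        using that by simp
      then obtain N where N: "\<forall>j \<in> {..n} \<union> prod_encode ` ({..n} \<times> {..n}) \<union> to_nat_on V ` Z. j < N"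
        using finite_nat_set_iff_bounded by blast
      obtain B where B: "B \<noteq> A" "\<And>j. j < N \<Longrightarrow> \<phi> j B = \<phi> j A"
        using A by blast
      show ?thesis
      proof (intro exI[of _ B] exI[of _ "F B"] conjI allI impI)
        show "B x = A x" if "x \<le> n" for x
          using N[rule_format, of x] B(2)[of x] that unfolding \<phi>_def by blast
        show "F B (x, y) = F A (x, y)" if "x \<le> n" "y \<le> n" for x y
        proof -
          have "prod_encode (x, y) < N"
            using N[rule_format, of "prod_encode (x, y)"] that by blast
          then have "to_nat_on V (F B (x, y)) = to_nat_on V (F A (x, y))"
            using B(2)[of "prod_encode (x, y)"] unfolding \<phi>_def by simp
          moreover have "F B (x, y) \<in> V" "F A (x, y) \<in> V"
            using F(2) by blast+
          ultimately show ?thesis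
            using to_nat_on_inj[OF \<open>countable V\<close>] by blast
        qed
        show "range (F B) \<inter> Z \<subseteq> range (F A)"
        proof
          fix z
          assume z: "z \<in> range (F B) \<inter> Z"
          then have "to_nat_on V z < N" and "z \<in> V"
            using N[rule_format, of "to_nat_on V z"] F(2)[of B] by blast+
          then have "z \<in> range (F B) \<longleftrightarrow> z \<in> range (F A)"
            using B(2)[of "to_nat_on V z"] from_nat_into_to_nat_on[OF \<open>countable V\<close>]
            unfolding \<phi>_def prod.inject by simp
          with z show "z \<in> range (F A)"
            by simp
        qed
      qed (use B(1) F in blast)+
    qed
  qed (use F in blast)+
qed

subsection \<open>Two close embeddings create a detour\<close>

definition linked :: "('a \<Rightarrow> 'a \<Rightarrow> bool) \<Rightarrow> 'a set \<Rightarrow> bool" where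
  "linked E S \<longleftrightarrow> (\<forall>x\<in>S. \<forall>y\<in>S. (\<lambda>a b. a \<in> S \<and> b \<in> S \<and> E a b)\<^sup>*\<^sup>* x y)"

lemma linked_singleton: "linked E {x}"
  by (simp add: linked_def)

lemma linked_Un:
  assumes sym: "\<And>x y. E x y \<Longrightarrow> E y x"
    and "linked E S" and "linked E T" and "a \<in> S" and "b \<in> T" and "a = b \<or> E a b"
  shows "linked E (S \<union> T)"
proof -
  let ?R = "\<lambda>a b. a \<in> S \<union> T \<and> b \<in> S \<union> T \<and> E a b"
  have S: "?R\<^sup>*\<^sup>* x y" if "x \<in> S" "y \<in> S" for x y
    using assms(2) that unfolding linked_def
    by (auto elim!: rtranclp_mono[THEN predicate2D, rotated])
  have T: "?R\<^sup>*\<^sup>* x y" if "x \<in> T" "y \<in> T" for x y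
    using assms(3) that unfolding linked_def
    by (auto elim!: rtranclp_mono[THEN predicate2D, rotated])
  have "?R\<^sup>*\<^sup>* a b" "?R\<^sup>*\<^sup>* b a"
    using assms(4-6) sym by (auto intro: r_into_rtranclp)
  then have "?R\<^sup>*\<^sup>* x y" "?R\<^sup>*\<^sup>* y x" if "x \<in> S" "y \<in> T" for x y
    using that S T \<open>a \<in> S\<close> \<open>b \<in> T\<close> by (meson rtranclp_trans)+
  then show ?thesis
    using S T unfolding linked_def by blast
qed

lemma linked_insert:
  assumes "\<And>x y. E x y \<Longrightarrow> E y x" and "linked E S" and "s \<in> S" and "E x s"
  shows "linked E (insert x S)"
  using linked_Un[of E "{x}" S x s] assms linked_singleton by fastforce

lemma adj_commute: "adj t A p q \<longleftrightarrow> adj t A q p"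
  by (auto simp: adj_def)

lemma adj_iff:
  assumes "2 \<le> x"
  shows "adj t A (x, y) (x', y') \<longleftrightarrow>
    x' = x \<and> (y' = Suc y \<or> y = Suc y') \<or>
    x' = Suc x \<and> (y' = y \<or> y' = Suc y \<and> \<not> anti A x y \<or> y = Suc y' \<and> anti A x y') \<or>
    x = Suc x' \<and> (y' = y \<or> y = Suc y' \<and> \<not> anti A x' y' \<or> y' = Suc y \<and> anti A x' y)"
  using assms by (auto simp: adj_def fwd_def)

locale two_embeddings =
  fixes E :: "'a \<Rightarrow> 'a \<Rightarrow> bool" and t :: nat and A B :: "nat \<Rightarrow> bool"
    and f g :: "nat \<times> nat \<Rightarrow> 'a" and n L :: nat
  assumes sym: "\<And>x y. E x y \<Longrightarrow> E y x"
    and inj_f: "inj f" and inj_g: "inj g"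
    and hom_f: "\<And>p q. adj t A p q \<Longrightarrow> E (f p) (f q)"
    and hom_g: "\<And>p q. adj t B p q \<Longrightarrow> E (g p) (g q)"
    and agree: "\<And>x y. x \<le> n \<Longrightarrow> y \<le> n \<Longrightarrow> g (x, y) = f (x, y)"
    and bits: "\<And>x. x \<le> n \<Longrightarrow> B x = A x"
    and L: "L mod 4 = 0" "4 \<le> L" "L + 20 \<le> n"
begin

definition K :: "nat \<Rightarrow> nat \<Rightarrow> bool" where
  "K x y \<longleftrightarrow> g (x, y) = f (x, y)"

text \<open>The rows are those of the core and three spare ones on either side, which give three
  candidates each for the lower and the upper side of the box around a detour.\<close>

definition zone :: "nat \<Rightarrow> (nat \<times> nat) set" where
  "zone x = {x - 3..x + 5} \<times> {L - 3..L + 10}"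

definition core :: "nat \<Rightarrow> (nat \<times> nat) set" where
  "core x = {x - 1..x + 2} \<times> {L..L + 7}"

text \<open>An obstruction to agreement, in the form that becomes a detour. If \<open>J\<close> is
  empty, a box slightly larger than the zone encloses the ends. Otherwise the ends must lie in the
  core, so that a box around them fits into the zone, where \<open>J\<close> misses the
  lattice.\<close>

definition jump :: "nat \<Rightarrow> nat \<times> nat \<Rightarrow> nat \<times> nat \<Rightarrow> 'a set \<Rightarrow> bool" where
  "jump x u v J \<longleftrightarrow> u \<noteq> v \<and> \<not> adj t A u v \<and> u \<in> zone x \<and> v \<in> zone x \<and>
     (J = {} \<or> u \<in> core x \<and> v \<in> core x) \<and>
     J \<subseteq> range g - f ` ({..n} \<times> {..n}) \<and> J \<inter> f ` zone x = {} \<and>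
     finite J \<and> card J \<le> 2 \<and> linked E (insert (f u) (insert (f v) J))"

text \<open>On the square \<open>{..n} \<times> {..n}\<close> the images under \<open>f\<close> are
  already taken by \<open>g\<close> at the same points, and \<open>g\<close> is injective.\<close>

lemma not_K: "\<not> K x y \<Longrightarrow> g (x, y) \<notin> f ` ({..n} \<times> {..n})"
proof
  assume "\<not> K x y" "g (x, y) \<in> f ` ({..n} \<times> {..n})"
  then obtain x' y' where "x' \<le> n" "y' \<le> n" "g (x, y) = f (x', y')"
    by auto
  then have "g (x, y) = g (x', y')"
    by (simp add: agree)
  then have "(x, y) = (x', y')"
    using inj_g by (simp add: inj_eq)
  with \<open>\<not> K x y\<close> \<open>x' \<le> n\<close> \<open>y' \<le> n\<close> show False
    by (simp add: K_def agree)
qed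

lemma link: "linked E S \<Longrightarrow> s \<in> S \<Longrightarrow> E x s \<Longrightarrow> linked E (insert x S)"
  using linked_insert[of E S s x] sym by blast

lemma edge_jump:
  assumes "\<not> adj t A u v" and "u \<noteq> v" and "u \<in> zone x" and "v \<in> zone x" and "E (f u) (f v)"
  shows "jump x u v {}"
  using assms link[OF linked_singleton, of "f v" "f v" "f u"] by (simp add: jump_def)

context
  fixes x :: nat
  assumes no_jump: "\<And>u v J. \<not> jump x u v J" and x: "n \<le> x"
begin

text \<open>A triangulation edge has only two common neighbours, so where \<open>g\<close> first departs from \<open>f\<close> it either
  leaves the lattice \<open>f\<close> (at least within the zone) or provides an edge of \<open>E\<close> missing in it.\<close>
lemma new_vertex:
  assumes adj: "adj t B (zx, zy) (ax, ay)" "adj t B (zx, zy) (cx, cy)"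
    and K: "K ax ay" "K cx cy" "\<not> K zx zy"
    and zone: "(ax, ay) \<in> zone x" "(cx, cy) \<in> zone x"
    and common: "\<And>qx qy. adj t A (ax, ay) (qx, qy) \<Longrightarrow> adj t A (cx, cy) (qx, qy) \<Longrightarrow>
      (qx, qy) = (zx, zy) \<or> K qx qy"
  shows "g (zx, zy) \<notin> f ` zone x"
proof
  assume "g (zx, zy) \<in> f ` zone x"
  then obtain qx qy where q: "(qx, qy) \<in> zone x" "g (zx, zy) = f (qx, qy)"
    by auto
  have nK: "\<not> K qx qy"
    using q K inj_g by (auto simp: K_def inj_def) metis
  have "E (f (ax, ay)) (f (qx, qy))" "E (f (cx, cy)) (f (qx, qy))"
    using hom_g[OF adj(1)] hom_g[OF adj(2)] K sym unfolding K_def q(2) by auto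
  moreover have "(ax, ay) \<noteq> (qx, qy)" "(cx, cy) \<noteq> (qx, qy)"
    using nK K by auto
  ultimately have "adj t A (ax, ay) (qx, qy)" "adj t A (cx, cy) (qx, qy)"
    using edge_jump no_jump zone q(1) by blast+
  from common[OF this] show False
    using nK K(3) q(2) by (auto simp: K_def)
qed

text \<open>One departing vertex between two agreeing ones yields an obstruction, and so do two
  consecutive ones in \<open>no_path2\<close>; this is the source of the bound 2 on
  \<open>card J\<close>.\<close>

lemma no_path1:
  assumes w: "\<not> K wx wy" "g (wx, wy) \<notin> f ` zone x"
    and adj: "adj t B (ux, uy) (wx, wy)" "adj t B (wx, wy) (vx, vy)"
    and K: "K ux uy" "K vx vy" and core: "(ux, uy) \<in> core x" "(vx, vy) \<in> core x"
    and nonadj: "(ux, uy) \<noteq> (vx, vy)" "\<not> adj t A (ux, uy) (vx, vy)"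
  shows False
proof -
  have "E (f (ux, uy)) (g (wx, wy))" "E (g (wx, wy)) (f (vx, vy))"
    using hom_g[OF adj(1)] hom_g[OF adj(2)] K by (auto simp: K_def)
  then have "linked E {f (ux, uy), f (vx, vy), g (wx, wy)}"
    using link[OF link[OF linked_singleton], of "g (wx, wy)" _ "f (vx, vy)" "g (wx, wy)"] sym by blast
  then have "jump x (ux, uy) (vx, vy) {g (wx, wy)}"
    using w not_K core nonadj unfolding jump_def by (auto simp: core_def zone_def)
  with no_jump show False
    by blast
qed

lemma no_path2:
  assumes w: "\<not> K wx wy" "g (wx, wy) \<notin> f ` zone x"
    and w': "\<not> K wx' wy'" "g (wx', wy') \<notin> f ` zone x"
    and adj: "adj t B (ux, uy) (wx, wy)" "adj t B (wx, wy) (wx', wy')" "adj t B (wx', wy') (vx, vy)"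
    and K: "K ux uy" "K vx vy" and core: "(ux, uy) \<in> core x" "(vx, vy) \<in> core x"
    and nonadj: "(ux, uy) \<noteq> (vx, vy)" "\<not> adj t A (ux, uy) (vx, vy)"
  shows False
proof -
  have E: "E (f (ux, uy)) (g (wx, wy))" "E (g (wx, wy)) (g (wx', wy'))" "E (g (wx', wy')) (f (vx, vy))"
    using hom_g[OF adj(1)] hom_g[OF adj(2)] hom_g[OF adj(3)] K by (auto simp: K_def)
  have "linked E {g (wx, wy), g (wx', wy')}"
    using link[OF linked_singleton] E by blast
  then have "linked E {f (vx, vy), g (wx, wy), g (wx', wy')}"
    using link[of "{g (wx, wy), g (wx', wy')}" "g (wx', wy')" "f (vx, vy)"] E sym by blast
  then have "linked E {f (ux, uy), f (vx, vy), g (wx, wy), g (wx', wy')}"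
    using link[of "{f (vx, vy), g (wx, wy), g (wx', wy')}" "g (wx, wy)" "f (ux, uy)"] E sym by blast
  then have "jump x (ux, uy) (vx, vy) {g (wx, wy), g (wx', wy')}"
    using w w' not_K core nonadj unfolding jump_def by (auto simp: core_def zone_def card_insert_if)
  with no_jump show False
    by blast
qed

lemma not_anti: "S mod 4 = 0 \<Longrightarrow> S \<le> y \<Longrightarrow> y < S + 3 \<Longrightarrow> \<not> anti C z y"
  by (auto simp: anti_def) presburger

text \<open>The vertex \<open>(Suc X, y)\<close> forms a triangle with \<open>(X, y - 1)\<close> and
  \<open>(X, y)\<close>. The other triangle on that edge has its apex \<open>(X - 1, y - 1)\<close>
  in an agreeing column, so a departing image leaves the zone. Below the top row, continuing to
  \<open>(Suc X, Suc y)\<close> and, if that departs too, back to \<open>(X, Suc y)\<close> reaches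
  an agreeing non-neighbour of \<open>(X, y - 1)\<close>. The parameter \<open>l\<close> permits a
  second use with the lowest row removed.\<close>

lemma column_step:
  assumes S: "S mod 4 = 0" "L \<le> S" "S \<le> L + 4" and l: "S \<le> l" "l \<le> Suc S"
    and X: "X = x \<or> X = Suc x"
    and K: "\<And>y. l \<le> y \<Longrightarrow> y \<le> S + 3 \<Longrightarrow> K (X - 1) y \<and> K X y"
    and y: "l < y" "y \<le> S + 3"
  shows "K (Suc X) y"
proof -
  have x2: "20 \<le> x"
    using x L by linarith
  have na: "\<not> anti C z y" if "S \<le> y" "y < S + 3" for C z y
    using not_anti[OF S(1) that] .
  have new: "g (Suc X, y) \<notin> f ` zone x" if "\<not> K (Suc X) y" "l < y" "y \<le> S + 3" for y
  proof -
    obtain y' where y': "y = Suc y'"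
      using \<open>l < y\<close> by (cases y) auto
    have na': "\<not> anti C z y'" for C z
      using na that l unfolding y' by simp
    show ?thesis
    proof (rule new_vertex[of "Suc X" y X y' X y])
      fix qx qy
      assume "adj t A (X, y') (qx, qy)" "adj t A (X, y) (qx, qy)"
      then have "(qx, qy) = (Suc X, y) \<or> (qx, qy) = (X - 1, y')"
        using X x2 na' unfolding y' by (auto simp: adj_iff)
      then show "(qx, qy) = (Suc X, y) \<or> K qx qy"
        using K[of y'] that y' by auto
    qed (use X x2 na' K that y' S L l in \<open>auto simp: adj_iff zone_def\<close>)
  qed
  have below: "K (Suc X) y" if "l < y" "y < S + 3" for y
  proof (rule ccontr)
    assume nK: "\<not> K (Suc X) y"
    obtain y' where y': "y = Suc y'"
      using \<open>l < y\<close> by (cases y) auto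
    have na': "\<not> anti C z y'" "\<not> anti C z y" for C z
      using na that l unfolding y' by simp_all
    show False
    proof (cases "K (Suc X) (Suc y)")
      case True
      show False
        by (rule no_path1[of "Suc X" y X y' "Suc X" "Suc y"])
          (use nK new True X x2 na' K that y' S L l in \<open>auto simp: adj_iff core_def\<close>)
    next
      case False
      show False
        by (rule no_path2[of "Suc X" y "Suc X" "Suc y" X y' X "Suc y"])
          (use nK new False X x2 na' K that y' S L l in \<open>auto simp: adj_iff core_def\<close>)
    qed
  qed
  show ?thesis
  proof (cases "y < S + 3")
    case True
    with below y show ?thesis
      by blast
  next
    case False
    then have y': "y = Suc (S + 2)"
      using y by simp
    have na': "\<not> anti C z (S + 2)" for C z
      using na by simp
    show ?thesis
    proof (rule ccontr)
      assume nK: "\<not> K (Suc X) y"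
      \<comment> \<open>In the top row the way back to agreement leads down; the ends
        \<open>(X, S + 3)\<close> and \<open>(Suc X, S + 2)\<close> span the absent diagonal of a
        square.\<close>
      have "K (Suc X) (S + 2)"
        using below l by simp
      show False
        by (rule no_path1[of "Suc X" y X y "Suc X" "S + 2"])
          (use nK new \<open>K (Suc X) (S + 2)\<close> X x2 na' K y y' S L l in \<open>auto simp: adj_iff core_def\<close>)
    qed
  qed
qed

text \<open>Squares with variable diagonal lie above the rows \<open>y\<close> with \<open>y mod 4 = 3\<close>, so four consecutive rows
  starting at a multiple of 4 form a strip with constant diagonals. By \<open>column_step\<close>, agreement of \<open>f\<close> and
  \<open>g\<close> on two columns of the strip passes to the next column except for its lowest vertex, which is
  settled by looking one column further.\<close>
lemma strip_step:
  assumes S: "S mod 4 = 0" "L \<le> S" "S \<le> L + 4"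
    and K: "\<And>y. S \<le> y \<Longrightarrow> y \<le> S + 3 \<Longrightarrow> K (x - 1) y \<and> K x y"
    and y: "S \<le> y" "y \<le> S + 3"
  shows "K (Suc x) y"
proof (cases "y = S")
  case False
  with y have "S < y"
    by simp
  then show ?thesis
    using column_step[of S S x y] S K y by auto
next
  case True
  have x2: "20 \<le> x"
    using x L by linarith
  have na: "\<not> anti C z y" if "S \<le> y" "y < S + 3" for C z y
    using not_anti[OF S(1) that] .
  have K1: "K (Suc x) y" if "S < y" "y \<le> S + 3" for y
    using column_step[of S S x y] S K that by auto
  \<comment> \<open>This use starts one row higher, as \<open>(Suc x, S)\<close> is not yet known to
    agree. Treating its top row requires row \<open>S + 2\<close> to lie strictly above
    \<open>l = Suc S\<close>, which accounts for the four rows of a strip.\<close>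
  have K2: "K (Suc (Suc x)) y" if "Suc S < y" "y \<le> S + 3" for y
    using column_step[of S "Suc S" "Suc x" y] S K K1 that by auto
  show ?thesis
  proof (rule ccontr)
    assume "\<not> K (Suc x) y"
    then have nK: "\<not> K (Suc x) S"
      using True by simp
    have new: "g (Suc x, S) \<notin> f ` zone x"
    proof (rule new_vertex[of "Suc x" S x S "Suc x" "Suc S"])
      fix qx qy
      assume "adj t A (x, S) (qx, qy)" "adj t A (Suc x, Suc S) (qx, qy)"
      then have "(qx, qy) = (Suc x, S) \<or> (qx, qy) = (x, Suc S)"
        using x2 na[of S] na[of "Suc S"] by (auto simp: adj_iff)
      then show "(qx, qy) = (Suc x, S) \<or> K qx qy"
        using K by auto
    qed (use x2 na K K1 nK S L in \<open>auto simp: adj_iff zone_def\<close>)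
    show False
    \<comment> \<open>The path goes along the diagonal to \<open>(Suc (Suc x), Suc S)\<close> and,
      if that departs, up to \<open>(Suc (Suc x), Suc (Suc S))\<close>, which agrees by
      \<open>K2\<close>. Either end is two columns away from \<open>(x, S)\<close>, hence not
      adjacent to it.\<close>
    proof (cases "K (Suc (Suc x)) (Suc S)")
      case True
      show False
        by (rule no_path1[of "Suc x" S x S "Suc (Suc x)" "Suc S"])
          (use nK new True x2 na K S L in \<open>auto simp: adj_iff core_def\<close>)
    next
      case False
      have new': "g (Suc (Suc x), Suc S) \<notin> f ` zone x"
      proof (rule new_vertex[of "Suc (Suc x)" "Suc S" "Suc x" "Suc S" "Suc (Suc x)" "Suc (Suc S)"])
        fix qx qy
        assume "adj t A (Suc x, Suc S) (qx, qy)" "adj t A (Suc (Suc x), Suc (Suc S)) (qx, qy)"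
        then have "(qx, qy) = (Suc (Suc x), Suc S) \<or> (qx, qy) = (Suc x, Suc (Suc S))"
          using x2 na[of S] na[of "Suc S"] na[of "Suc (Suc S)"] by (auto simp: adj_iff)
        then show "(qx, qy) = (Suc (Suc x), Suc S) \<or> K qx qy"
          using K1 by auto
      qed (use x2 na K1 K2 False S L in \<open>auto simp: adj_iff zone_def\<close>)
      show False
        by (rule no_path2[of "Suc x" S "Suc (Suc x)" "Suc S" x S "Suc (Suc x)" "Suc (Suc S)"])
          (use nK new new' False x2 na K K2 S L in \<open>auto simp: adj_iff core_def\<close>)
    qed
  qed
qed

end

text \<open>The diagonals inside a strip are the same for all bit sequences, so agreement spreads
  from the first \<open>n\<close> columns to all others whatever \<open>A\<close> and
  \<open>B\<close> are.\<close>

lemma strip_agrees: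
  assumes no_jump: "\<And>x u v J. n \<le> x \<Longrightarrow> \<not> jump x u v J"
    and S: "S mod 4 = 0" "L \<le> S" "S \<le> L + 4" and y: "S \<le> y" "y \<le> S + 3"
  shows "K x y"
proof -
  have "\<forall>y. S \<le> y \<and> y \<le> S + 3 \<longrightarrow> K (n + k - 1) y \<and> K (n + k) y" for k
  proof (induction k)
    case 0
    then show ?case
      using agree S L by (auto simp: K_def)
  next
    case (Suc k)
    then show ?case
      using strip_step[of "n + k" S] no_jump S by auto
  qed
  from this[of "x - n"] show ?thesis
    using agree[of x y] S L y by (cases "x \<le> n") (auto simp: K_def)
qed

text \<open>Without an obstruction the strips starting at \<open>L\<close> and \<open>L + 4\<close>
  agree everywhere, and so do the corners of all squares above row \<open>L + 3\<close>. Where the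
  bits differ, \<open>g\<close> then supplies the diagonal that the lattice of \<open>f\<close>
  lacks.\<close>

lemma ex_jump:
  assumes "B \<noteq> A"
  shows "\<exists>x u v J. n \<le> x \<and> jump x u v J"
proof (rule ccontr)
  assume "\<not> ?thesis"
  then have no_jump: "\<And>x u v J. n \<le> x \<Longrightarrow> \<not> jump x u v J"
    by blast
  have K: "K x y" if "L \<le> y" "y \<le> L + 7" for x y
    using strip_agrees[OF no_jump, of L y x] strip_agrees[OF no_jump, of "L + 4" y x] L that
    by (cases "y \<le> L + 3") auto
  obtain x where x: "B x \<noteq> A x"
    using assms by blast
  then have "n \<le> x"
    using bits by (meson nat_le_linear)
  have "2 \<le> x"
    using \<open>n \<le> x\<close> L by linarith
  have m: "(L + 3) mod 4 = 3"
    using L(1) by presburger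
  show False
  proof (cases "A x")
    case True
    have "adj t B (x, L + 3) (Suc x, L + 4)"
      using x True m \<open>2 \<le> x\<close> by (auto simp: adj_iff anti_def)
    then have "E (f (x, L + 3)) (f (Suc x, L + 4))"
      using hom_g K by (fastforce simp: K_def)
    moreover have "\<not> adj t A (x, L + 3) (Suc x, L + 4)"
      using x True m \<open>2 \<le> x\<close> by (auto simp: adj_iff anti_def)
    ultimately show False
      using edge_jump[of "(x, L + 3)" "(Suc x, L + 4)" x] no_jump \<open>n \<le> x\<close>
      by (auto simp: zone_def le_diff_conv)
  next
    case False
    have "adj t B (x, L + 4) (Suc x, L + 3)"
      using x False m \<open>2 \<le> x\<close> by (auto simp: adj_iff anti_def)
    then have "E (f (x, L + 4)) (f (Suc x, L + 3))"
      using hom_g K by (fastforce simp: K_def)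
    moreover have "\<not> adj t A (x, L + 4) (Suc x, L + 3)"
      using x False m \<open>2 \<le> x\<close> by (auto simp: adj_iff anti_def)
    ultimately show False
      using edge_jump[of "(x, L + 4)" "(Suc x, L + 3)" x] no_jump \<open>n \<le> x\<close>
      by (auto simp: zone_def le_diff_conv)
  qed
qed

end

subsection \<open>Exchanging two rails along a detour\<close>

text \<open>Applied with \<open>R\<close> the rows in which a detour meets the lattice.\<close>

lemma ex_avoiding_row:
  assumes "finite R" and "card R \<le> 2"
  shows "\<exists>y\<in>{a..a + 2 :: nat}. y \<notin> R"
proof (rule ccontr)
  assume "\<not> ?thesis"
  then have "card {a..a + 2} \<le> card R"
    using assms(1) by (intro card_mono) auto
  with assms(2) show False
    by simp
qed

definition hseg :: "nat \<Rightarrow> nat \<Rightarrow> nat \<Rightarrow> (nat \<times> nat) set" where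
  "hseg a b y = {a..b} \<times> {y}"

definition vseg :: "nat \<Rightarrow> nat \<Rightarrow> nat \<Rightarrow> (nat \<times> nat) set" where
  "vseg x a b = {x} \<times> {a..b}"

lemma mem_hseg [simp]: "(x, y') \<in> hseg a b y \<longleftrightarrow> a \<le> x \<and> x \<le> b \<and> y' = y"
  by (auto simp: hseg_def)

lemma mem_vseg [simp]: "(x', y) \<in> vseg x a b \<longleftrightarrow> x' = x \<and> a \<le> y \<and> y \<le> b"
  by (auto simp: vseg_def)

locale embedded_lattice =
  fixes V :: "'a set" and E :: "'a \<Rightarrow> 'a \<Rightarrow> bool" and t :: nat and A :: "nat \<Rightarrow> bool"
    and f :: "nat \<times> nat \<Rightarrow> 'a"
  assumes sym: "\<And>x y. E x y \<Longrightarrow> E y x"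
    and inj_f: "inj f" and range_f: "range f \<subseteq> V"
    and hom: "\<And>p q. adj t A p q \<Longrightarrow> E (f p) (f q)"
    and accumulation: "\<And>n Z. finite Z \<Longrightarrow> \<exists>B g. B \<noteq> A \<and> (\<forall>x\<le>n. B x = A x) \<and> inj g \<and> range g \<subseteq> V \<and>
       (\<forall>p q. adj t B p q \<longrightarrow> E (g p) (g q)) \<and>
       (\<forall>x\<le>n. \<forall>y\<le>n. g (x, y) = f (x, y)) \<and> range g \<inter> Z \<subseteq> range f"
begin

text \<open>\<open>J\<close> may contain lattice vertices outside the box. It avoids the rows
  \<open>c\<close> and \<open>d\<close> in full length because the two rails to be exchanged arrive
  at the box and leave it along these rows.\<close>

definition detour :: "nat \<Rightarrow> nat \<Rightarrow> nat \<Rightarrow> nat \<Rightarrow> nat \<times> nat \<Rightarrow> nat \<times> nat \<Rightarrow> 'a set \<Rightarrow> bool" where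
  "detour a b c d u v J \<longleftrightarrow>
     a < fst u \<and> fst u < b \<and> c < snd u \<and> snd u < d \<and>
     a < fst v \<and> fst v < b \<and> c < snd v \<and> snd v < d \<and>
     u \<noteq> v \<and> \<not> adj t A u v \<and> finite J \<and> card J \<le> 2 \<and> J \<subseteq> V \<and>
     J \<inter> f ` ({a..b} \<times> {c..d}) = {} \<and> (\<forall>x. f (x, c) \<notin> J \<and> f (x, d) \<notin> J) \<and>
     linked E (insert (f u) (insert (f v) J))"

lemma finite_rows:
  assumes "finite J" and "card J \<le> k"
  shows "finite {y. \<exists>x. f (x, y) \<in> J}" and "card {y. \<exists>x. f (x, y) \<in> J} \<le> k"
proof -
  have eq: "{y. \<exists>x. f (x, y) \<in> J} = snd ` (f -` J)"
    by force
  have fin: "finite (f -` J)"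
    using assms(1) inj_f by (rule finite_vimageI)
  then show "finite {y. \<exists>x. f (x, y) \<in> J}"
    by (simp add: eq)
  have "card (snd ` (f -` J)) \<le> card (f -` J)"
    using fin by (rule card_image_le)
  also have "\<dots> \<le> card J"
    using card_vimage_inj_on_le[OF inj_f assms(1)] by simp
  finally show "card {y. \<exists>x. f (x, y) \<in> J} \<le> k"
    using assms(2) eq by simp
qed

text \<open>\<open>L\<close> fixes the height, while \<open>n\<close> pushes the detour to the
  right. Once \<open>n\<close> exceeds the coordinates of all lattice vertices in \<open>Z\<close>,
  the last two conclusions together give \<open>J \<inter> Z = {}\<close>.\<close>

lemma ex_detour:
  assumes L: "L mod 4 = 0" "4 \<le> L" "L + 20 \<le> n" and Z: "finite Z"
  obtains a b c d u v J where "detour a b c d u v J" "n \<le> a + 4" "L - 4 \<le> c" "d \<le> L + 11"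
    "J \<inter> Z \<subseteq> range f" "J \<inter> f ` ({..n} \<times> {..n}) = {}"
proof -
  obtain B g where B: "B \<noteq> A" "\<And>x. x \<le> n \<Longrightarrow> B x = A x" and g: "inj g" "range g \<subseteq> V"
    "\<And>p q. adj t B p q \<Longrightarrow> E (g p) (g q)"
    "\<And>x y. x \<le> n \<Longrightarrow> y \<le> n \<Longrightarrow> g (x, y) = f (x, y)" "range g \<inter> Z \<subseteq> range f"
    using accumulation[OF Z, of n] by metis
  interpret two_embeddings E t A B f g n L
    by unfold_locales (use sym inj_f hom B g L in auto)
  obtain x u v J where x: "n \<le> x" and jump: "jump x u v J"
    using ex_jump[OF B(1)] by blast
  have J: "u \<noteq> v" "\<not> adj t A u v" "finite J" "card J \<le> 2" "linked E (insert (f u) (insert (f v) J))"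
    "J \<inter> f ` zone x = {}" "J \<subseteq> range g" "J \<inter> f ` ({..n} \<times> {..n}) = {}"
    using jump by (auto simp: jump_def)
  show thesis
  proof (cases "J = {}")
    case True
    have "detour (x - 4) (x + 6) (L - 4) (L + 11) u v J"
      using jump x L unfolding detour_def True jump_def by (auto simp: zone_def)
    then show ?thesis
      using that x True by auto
  next
    case False
    then have core: "u \<in> core x" "v \<in> core x"
      using jump by (auto simp: jump_def)
    obtain c where c: "c \<in> {L - 3..L - 3 + 2}" "c \<notin> {y. \<exists>x. f (x, y) \<in> J}"
      using ex_avoiding_row[OF finite_rows[OF J(3,4)]] by blast
    obtain d where d: "d \<in> {L + 8..L + 8 + 2}" "d \<notin> {y. \<exists>x. f (x, y) \<in> J}"
      using ex_avoiding_row[OF finite_rows[OF J(3,4)]] by blast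
    have "{x - 3..x + 5} \<times> {c..d} \<subseteq> zone x"
      using c(1) d(1) L by (auto simp: zone_def)
    then have "J \<inter> f ` ({x - 3..x + 5} \<times> {c..d}) = {}"
      using J(6) by blast
    then have "detour (x - 3) (x + 5) c d u v J"
      using J core c d x L g(2) unfolding detour_def by (auto simp: core_def)
    then show ?thesis
    proof (rule that)
      show "n \<le> x - 3 + 4" "L - 4 \<le> c" "d \<le> L + 11"
        using x c(1) d(1) L by auto
    qed (use J(7,8) g(5) in auto)
  qed
qed

lemma linked_join:
  "linked E (f ` S) \<Longrightarrow> linked E (f ` T) \<Longrightarrow> p \<in> S \<Longrightarrow> p \<in> T \<Longrightarrow> linked E (f ` (S \<union> T))"
  unfolding image_Un by (rule linked_Un[where a = "f p" and b = "f p"]) (auto dest: sym)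

lemma linked_join_edge:
  "linked E (f ` S) \<Longrightarrow> linked E (f ` T) \<Longrightarrow> p \<in> S \<Longrightarrow> q \<in> T \<Longrightarrow> adj t A p q \<Longrightarrow>
    linked E (f ` (S \<union> T))"
  unfolding image_Un by (rule linked_Un[where a = "f p" and b = "f q"]) (auto dest: sym hom)

lemma linked_detour:
  assumes "linked E (f ` S)" and "linked E (f ` T)" and "u \<in> S" and "v \<in> T"
    and "linked E (insert (f u) (insert (f v) J))"
  shows "linked E (f ` (S \<union> T) \<union> J)"
proof -
  have *: "linked E (f ` S \<union> insert (f u) (insert (f v) J))"
    by (rule linked_Un[where a = "f u" and b = "f u"]) (use assms sym in auto)
  have "linked E ((f ` S \<union> insert (f u) (insert (f v) J)) \<union> f ` T)"
    by (rule linked_Un[OF _ *, where a = "f v" and b = "f v"]) (use assms sym in auto)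
  moreover have "(f ` S \<union> insert (f u) (insert (f v) J)) \<union> f ` T = f ` (S \<union> T) \<union> J"
    using assms(3,4) by auto
  ultimately show ?thesis
    by simp
qed

lemma linked_hseg:
  assumes "0 < a" and "a \<le> b"
  shows "linked E (f ` hseg a b y)"
  using assms(2)
proof (induction b rule: dec_induct)
  case base
  have "hseg a a y = {(a, y)}"
    by (auto simp: hseg_def)
  then show ?case
    by (simp add: linked_singleton)
next
  case (step b)
  have "hseg a (Suc b) y = hseg a b y \<union> {(Suc b, y)}"
    using step by (auto simp: hseg_def)
  moreover have "adj t A (b, y) (Suc b, y)"
    using step assms by (simp add: adj_def fwd_def)
  ultimately show ?case
    using step linked_join_edge[of "hseg a b y" "{(Suc b, y)}" "(b, y)" "(Suc b, y)"]
    by (simp add: linked_singleton)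
qed

lemma linked_vseg:
  assumes "0 < x" and "a \<le> b"
  shows "linked E (f ` vseg x a b)"
  using assms(2)
proof (induction b rule: dec_induct)
  case base
  have "vseg x a a = {(x, a)}"
    by (auto simp: vseg_def)
  then show ?case
    by (simp add: linked_singleton)
next
  case (step b)
  have "vseg x a (Suc b) = vseg x a b \<union> {(x, Suc b)}"
    using step by (auto simp: vseg_def)
  moreover have "adj t A (x, b) (x, Suc b)"
    using step assms by (simp add: adj_def fwd_def)
  ultimately show ?case
    using step linked_join_edge[of "vseg x a b" "{(x, Suc b)}" "(x, b)" "(x, Suc b)"]
    by (simp add: linked_singleton)
qed

lemma linked_hv: "0 < a \<Longrightarrow> a \<le> b \<Longrightarrow> c \<le> d \<Longrightarrow> a \<le> x \<Longrightarrow> x \<le> b \<Longrightarrow> c \<le> y \<Longrightarrow> y \<le> d \<Longrightarrow>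
    linked E (f ` (hseg a b y \<union> vseg x c d))"
  by (rule linked_join[of _ _ "(x, y)"]) (auto intro: linked_hseg linked_vseg)

text \<open>Disjoint connections from the lower left to the upper right and from the upper left to the lower
  right corner of the rectangle \<open>{a..b} \<times> {c..d}\<close>; in a planar rectangle they would have to cross.\<close>
definition swapper :: "nat \<Rightarrow> nat \<Rightarrow> nat \<Rightarrow> nat \<Rightarrow> 'a set \<Rightarrow> bool" where
  "swapper a b c d J \<longleftrightarrow> (\<exists>P Q J1 J2.
     P \<subseteq> {a..b} \<times> {c..d} \<and> Q \<subseteq> {a..b} \<times> {c..d} \<and> P \<inter> Q = {} \<and>
     (a, c) \<in> P \<and> (b, d) \<in> P \<and> (a, d) \<in> Q \<and> (b, c) \<in> Q \<and>
     J1 \<subseteq> J \<and> J2 \<subseteq> J \<and> J1 \<inter> J2 = {} \<and>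
     linked E (f ` P \<union> J1) \<and> linked E (f ` Q \<union> J2))"

text \<open>Column \<open>ux + 1\<close> lies strictly between the ends, so \<open>Q\<close> can
  descend there while the other connection leaps over it by the detour.\<close>

lemma swapper_horizontal:
  assumes "detour a b c d u v J" and "0 < a" and "fst u + 2 \<le> fst v"
  shows "swapper a b c d J"
proof -
  obtain ux uy vx vy where uv: "u = (ux, uy)" "v = (vx, vy)"
    by (metis surj_pair)
  have bounds: "a < ux" "ux + 2 \<le> vx" "vx < b" "c < uy" "uy < d" "c < vy" "vy < d"
    and J: "linked E (insert (f (ux, uy)) (insert (f (vx, vy)) J))"
    using assms unfolding detour_def uv by auto
  define S T where "S = hseg a ux uy \<union> vseg a c uy" and "T = hseg vx b vy \<union> vseg b vy d"
  define Q where "Q = hseg a (ux + 1) d \<union> (hseg (ux + 1) b c \<union> vseg (ux + 1) c d)"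
  have "linked E (f ` (S \<union> T) \<union> J)"
    using bounds \<open>0 < a\<close> J unfolding S_def T_def
    by (intro linked_detour[of _ _ "(ux, uy)" "(vx, vy)"] linked_hv) auto
  moreover have "linked E (f ` Q)"
    using bounds \<open>0 < a\<close> unfolding Q_def
    by (intro linked_join[of _ _ "(ux + 1, d)"] linked_hv linked_hseg) auto
  moreover have "(S \<union> T) \<inter> Q = {}"
    using bounds by (auto simp: S_def T_def Q_def)
  moreover have "S \<union> T \<subseteq> {a..b} \<times> {c..d}" "Q \<subseteq> {a..b} \<times> {c..d}"
    using bounds by (auto simp: S_def T_def Q_def)
  moreover have "(a, c) \<in> S \<union> T" "(b, d) \<in> S \<union> T" "(a, d) \<in> Q" "(b, c) \<in> Q"
    using bounds by (auto simp: S_def T_def Q_def)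
  ultimately show ?thesis
    unfolding swapper_def
    by (intro exI[of _ "S \<union> T"] exI[of _ Q] exI[of _ J] exI[of _ "{}"]) simp
qed

text \<open>The same idea, with row \<open>uy + 1\<close> between the ends as the passage for
  \<open>Q\<close>.\<close>

lemma swapper_vertical:
  assumes "detour a b c d u v J" and "0 < a" and "snd u + 2 \<le> snd v"
  shows "swapper a b c d J"
proof -
  obtain ux uy vx vy where uv: "u = (ux, uy)" "v = (vx, vy)"
    by (metis surj_pair)
  have bounds: "a < ux" "ux < b" "a < vx" "vx < b" "c < uy" "uy + 2 \<le> vy" "vy < d"
    and J: "linked E (insert (f (ux, uy)) (insert (f (vx, vy)) J))"
    using assms unfolding detour_def uv by auto
  define S T where "S = hseg a ux c \<union> vseg ux c uy" and "T = hseg vx b d \<union> vseg vx vy d"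
  define Q where "Q = vseg a (uy + 1) d \<union> (hseg a b (uy + 1) \<union> vseg b c (uy + 1))"
  have "linked E (f ` (S \<union> T) \<union> J)"
    using bounds \<open>0 < a\<close> J unfolding S_def T_def
    by (intro linked_detour[of _ _ "(ux, uy)" "(vx, vy)"] linked_hv) auto
  moreover have "linked E (f ` Q)"
    using bounds \<open>0 < a\<close> unfolding Q_def
    by (intro linked_join[of _ _ "(a, uy + 1)"] linked_hv linked_vseg) auto
  moreover have "(S \<union> T) \<inter> Q = {}"
    using bounds by (auto simp: S_def T_def Q_def)
  moreover have "S \<union> T \<subseteq> {a..b} \<times> {c..d}" "Q \<subseteq> {a..b} \<times> {c..d}"
    using bounds by (auto simp: S_def T_def Q_def)
  moreover have "(a, c) \<in> S \<union> T" "(b, d) \<in> S \<union> T" "(a, d) \<in> Q" "(b, c) \<in> Q"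
    using bounds by (auto simp: S_def T_def Q_def)
  ultimately show ?thesis
    unfolding swapper_def
    by (intro exI[of _ "S \<union> T"] exI[of _ Q] exI[of _ J] exI[of _ "{}"]) simp
qed

text \<open>The remaining case: the ends are opposite corners of a unit square whose other diagonal
  is an edge. Detour and diagonal cross in this square; the direction of the diagonal decides which
  of the two connections takes the detour.\<close>

lemma swapper_square:
  assumes bounds: "0 < a" "a < x" "Suc x < b" "c < y" "Suc y < d"
    and J: "finite J"
    and link: "linked E (insert (f (Suc x, y)) (insert (f (x, Suc y)) J)) \<and> adj t A (x, y) (Suc x, Suc y) \<or>
      linked E (insert (f (x, y)) (insert (f (Suc x, Suc y)) J)) \<and> adj t A (Suc x, y) (x, Suc y)"
  shows "swapper a b c d J"
proof -
  define S T where "S = hseg a (Suc x) c \<union> vseg (Suc x) c y" and "T = hseg x b d \<union> vseg x (Suc y) d"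
  define S' T' where "S' = hseg a x y \<union> vseg a y d" and "T' = hseg (Suc x) b (Suc y) \<union> vseg b c (Suc y)"
  have lin: "linked E (f ` S)" "linked E (f ` T)" "linked E (f ` S')" "linked E (f ` T')"
    using bounds unfolding S_def T_def S'_def T'_def by (auto intro!: linked_hv)
  have mem: "(Suc x, y) \<in> S" "(x, Suc y) \<in> T" "(x, y) \<in> S'" "(Suc x, Suc y) \<in> T'"
    using bounds unfolding S_def T_def S'_def T'_def by auto
  have geometry: "(S \<union> T) \<inter> (S' \<union> T') = {}" "S \<union> T \<subseteq> {a..b} \<times> {c..d}" "S' \<union> T' \<subseteq> {a..b} \<times> {c..d}"
    "(a, c) \<in> S \<union> T" "(b, d) \<in> S \<union> T" "(a, d) \<in> S' \<union> T'" "(b, c) \<in> S' \<union> T'"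
    using bounds by (auto simp: S_def T_def S'_def T'_def)
  show ?thesis
    using link
  proof
    assume *: "linked E (insert (f (Suc x, y)) (insert (f (x, Suc y)) J)) \<and> adj t A (x, y) (Suc x, Suc y)"
    then have "linked E (f ` (S \<union> T) \<union> J)" "linked E (f ` (S' \<union> T'))"
      using linked_detour[OF lin(1,2) mem(1,2)] linked_join_edge[OF lin(3,4) mem(3,4)] by auto
    with geometry show ?thesis
      unfolding swapper_def
      by (intro exI[of _ "S \<union> T"] exI[of _ "S' \<union> T'"] exI[of _ J] exI[of _ "{}"]) simp
  next
    assume *: "linked E (insert (f (x, y)) (insert (f (Suc x, Suc y)) J)) \<and> adj t A (Suc x, y) (x, Suc y)"
    then have "linked E (f ` (S \<union> T))" "linked E (f ` (S' \<union> T') \<union> J)"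
      using linked_join_edge[OF lin(1,2) mem(1,2)] linked_detour[OF lin(3,4) mem(3,4)] by auto
    with geometry show ?thesis
      unfolding swapper_def
      by (intro exI[of _ "S \<union> T"] exI[of _ "S' \<union> T'"] exI[of _ "{}"] exI[of _ J]) simp
  qed
qed

lemma swapper_detour:
  assumes det: "detour a b c d u v J" and a: "2 \<le> a"
  shows "swapper a b c d J"
proof -
  have det': "detour a b c d v u J"
    using det adj_commute[of t A u v] insert_commute[of "f u" "f v" J] unfolding detour_def by auto
  have a0: "0 < a"
    using a by simp
  consider "fst u + 2 \<le> fst v" | "fst v + 2 \<le> fst u" | "snd u + 2 \<le> snd v" | "snd v + 2 \<le> snd u"
    | "fst u \<le> Suc (fst v)" "fst v \<le> Suc (fst u)" "snd u \<le> Suc (snd v)" "snd v \<le> Suc (snd u)"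
    by linarith
  then show ?thesis
  proof cases
    case 5
    obtain ux uy vx vy where uv: "u = (ux, uy)" "v = (vx, vy)"
      by (metis surj_pair)
    have bounds: "a < ux" "ux < b" "a < vx" "vx < b" "c < uy" "uy < d" "c < vy" "vy < d"
      and J: "linked E (insert (f (ux, uy)) (insert (f (vx, vy)) J))" "finite J"
      and ne: "(ux, uy) \<noteq> (vx, vy)" "\<not> adj t A (ux, uy) (vx, vy)"
      using det unfolding detour_def uv by auto
    have J': "linked E (insert (f (vx, vy)) (insert (f (ux, uy)) J))"
      using J by (simp add: insert_commute)
    consider "vx = Suc ux" "vy = Suc uy" | "ux = Suc vx" "uy = Suc vy"
      | "ux = Suc vx" "vy = Suc uy" | "vx = Suc ux" "uy = Suc vy"
      using 5 ne bounds a unfolding uv by (fastforce simp: adj_iff)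
    then show ?thesis
    proof cases
      case 1
      then show ?thesis
        using bounds J J' ne a by (intro swapper_square[of a ux b c uy d]) (auto simp: adj_iff)
    next
      case 2
      then show ?thesis
        using bounds J J' ne a by (intro swapper_square[of a vx b c vy d]) (auto simp: adj_iff)
    next
      case 3
      then show ?thesis
        using bounds J J' ne a by (intro swapper_square[of a vx b c uy d]) (auto simp: adj_iff)
    next
      case 4
      then show ?thesis
        using bounds J J' ne a by (intro swapper_square[of a ux b c vy d]) (auto simp: adj_iff)
    qed
  qed (use swapper_horizontal[OF det a0] swapper_horizontal[OF det' a0]
      swapper_vertical[OF det a0] swapper_vertical[OF det' a0] in auto)
qed


subsection \<open>Rails\<close>

text \<open>The rail \<open>B (ls ! r)\<close> has arrived at row \<open>\<rho> r\<close> of column \<open>X\<close> and everything to the right is unused;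
  \<open>Z\<close> is a set of vertices to be avoided.\<close>
definition config :: "'a set \<Rightarrow> nat \<Rightarrow> 'l list \<Rightarrow> (nat \<Rightarrow> nat) \<Rightarrow> ('l \<Rightarrow> 'a set) \<Rightarrow> bool" where
  "config Z X ls \<rho> B \<longleftrightarrow> finite Z \<and> Z \<inter> f ` {p. X \<le> fst p} = {} \<and> 0 < X \<and> distinct ls \<and>
     (\<forall>s<length ls. \<forall>r<s. \<rho> r < \<rho> s) \<and>
     (\<forall>l\<in>set ls. finite (B l) \<and> linked E (B l) \<and> B l \<subseteq> V \<and> B l \<inter> Z = {}) \<and>
     (\<forall>l\<in>set ls. \<forall>l'\<in>set ls. l \<noteq> l' \<longrightarrow> B l \<inter> B l' = {}) \<and>
     (\<forall>r<length ls. B (ls ! r) \<inter> f ` {p. X \<le> fst p} = {f (X, \<rho> r)})"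

text \<open>The common bookkeeping for touching and exchanging: the rail at position
  \<open>r\<close> is prolonged by the lattice piece \<open>R r\<close> and the detour piece
  \<open>J r\<close>, and its new position is \<open>\<pi> r\<close>.\<close>

lemma config_extend:
  fixes ls ls' :: "'l list"
  assumes conf: "config Z X ls \<rho> B" and X': "X < X'"
    and len: "length ls' = length ls"
    and \<pi>: "\<And>r. r < length ls \<Longrightarrow> \<pi> r < length ls \<and> ls' ! \<pi> r = ls ! r"
      "\<And>s. s < length ls \<Longrightarrow> \<exists>r<length ls. s = \<pi> r"
    and \<sigma>: "\<And>r s. r < s \<Longrightarrow> s < length ls \<Longrightarrow> \<sigma> r < \<sigma> s"
    and R: "\<And>r. r < length ls \<Longrightarrow> finite (R r) \<and> (X, \<rho> r) \<in> R r \<and> R r \<subseteq> {p. X \<le> fst p} \<and>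
      R r \<inter> {p. X' \<le> fst p} = {(X', \<sigma> (\<pi> r))}"
    and J: "\<And>r. r < length ls \<Longrightarrow> finite (J r) \<and> J r \<subseteq> V \<and> J r \<inter> Z = {} \<and>
      (\<forall>l\<in>set ls. J r \<inter> B l = {}) \<and> J r \<inter> f ` {p. X' \<le> fst p} = {}"
    and lin: "\<And>r. r < length ls \<Longrightarrow> linked E (f ` R r \<union> J r)"
    and disj: "\<And>r s. r < s \<Longrightarrow> s < length ls \<Longrightarrow> (f ` R r \<union> J r) \<inter> (f ` R s \<union> J s) = {}"
  shows "\<exists>B'. config Z X' ls' \<sigma> B' \<and> (\<forall>l. B l \<subseteq> B' l) \<and> (\<forall>r<length ls. f ` R r \<subseteq> B' (ls ! r))"
proof -
  define C where "C r = f ` R r \<union> J r" for r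
  define B' where "B' l = B l \<union> \<Union>(C ` {r. r < length ls \<and> ls ! r = l})" for l
  have dist: "distinct ls"
    using conf by (simp add: config_def)
  have B': "B' (ls ! r) = B (ls ! r) \<union> C r" if "r < length ls" for r
  proof -
    have "{s. s < length ls \<and> ls ! s = ls ! r} = {r}"
      using that dist by (auto simp: nth_eq_iff_index_eq)
    then show ?thesis
      by (simp add: B'_def)
  qed
  have at: "B (ls ! r) \<inter> f ` {p. X \<le> fst p} = {f (X, \<rho> r)}" if "r < length ls" for r
    using conf that by (simp add: config_def)
  have B: "finite (B (ls ! r))" "linked E (B (ls ! r))" "B (ls ! r) \<subseteq> V" "B (ls ! r) \<inter> Z = {}"
    if "r < length ls" for r
    using conf that by (simp_all add: config_def)
  have CC: "C r \<inter> C s = {}" if "r < length ls" "s < length ls" "r \<noteq> s" for r s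
  proof (cases "r < s")
    case True
    then show ?thesis
      using disj[of r s] that by (simp add: C_def)
  next
    case False
    then show ?thesis
      using disj[of s r] that by (simp add: C_def Int_commute)
  qed
  have start: "f (X, \<rho> r) \<in> C r" if "r < length ls" for r
    using R[OF that] by (simp add: C_def)
  have BC: "B (ls ! s) \<inter> C r = {}" if "r < length ls" "s < length ls" "r \<noteq> s" for r s
  proof -
    have "B (ls ! s) \<inter> J r = {}"
      using J[OF that(1)] that(2) by (auto dest: nth_mem)
    \<comment> \<open>From column \<open>X\<close> on, rail \<open>s\<close> consists of its head
      \<open>f (X, \<rho> s)\<close> alone, which lies in \<open>C s\<close> and hence not in
      \<open>C r\<close>.\<close>
    moreover have "B (ls ! s) \<inter> f ` R r = {}"
    proof (rule equals0I)
      fix w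
      assume w: "w \<in> B (ls ! s) \<inter> f ` R r"
      then have "w \<in> f ` {p. X \<le> fst p}"
        using R[OF that(1)] by auto
      then have "w \<in> {f (X, \<rho> s)}"
        using w unfolding at[OF that(2), symmetric] by simp
      moreover have "w \<in> C r"
        using w by (simp add: C_def)
      ultimately have "w \<in> C r \<inter> C s"
        using start[OF that(2)] by simp
      then show False
        by (simp add: CC[OF that])
    qed
    ultimately show ?thesis
      by (simp add: C_def Int_Un_distrib)
  qed
  have BB: "B (ls ! r) \<inter> B (ls ! s) = {}" if "r < length ls" "s < length ls" "r \<noteq> s" for r s
    using conf that dist by (simp add: config_def nth_eq_iff_index_eq)
  have B'B': "B' (ls ! r) \<inter> B' (ls ! s) = {}" if "r < length ls" "s < length ls" "r \<noteq> s" for r s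
    unfolding B'[OF that(1)] B'[OF that(2)] Int_Un_distrib Int_Un_distrib2
    using BB[OF that] BC[OF that] BC[OF that(2,1) that(3)[symmetric]] CC[OF that]
    by (simp add: Int_commute)
  have set': "set ls' = set ls"
  proof (intro equalityI subsetI)
    fix l
    assume "l \<in> set ls'"
    then obtain s where "s < length ls" "l = ls' ! s"
      by (auto simp: in_set_conv_nth len)
    moreover from this obtain r where "r < length ls" "s = \<pi> r"
      using \<pi>(2) by blast
    ultimately show "l \<in> set ls"
      using \<pi>(1)[of r] by simp
  next
    fix l
    assume "l \<in> set ls"
    then obtain r where "r < length ls" "l = ls ! r"
      by (auto simp: in_set_conv_nth)
    then show "l \<in> set ls'"
      using \<pi>(1)[of r] nth_mem[of "\<pi> r" ls'] len by simp
  qed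
  have "card (set ls') = length ls'"
    using set' len dist by (simp add: distinct_card)
  then have dist': "distinct ls'"
    by (rule card_distinct)
  have Z: "finite Z" "Z \<inter> f ` {p. X \<le> fst p} = {}" "0 < X"
    using conf by (simp_all add: config_def)
  have sub: "{p. X' \<le> fst p} \<subseteq> {p :: nat \<times> nat. X \<le> fst p}"
    using X' by auto
  have Z': "Z \<inter> f ` {p. X' \<le> fst p} = {}"
    using Z(2) sub by blast
  have each: "finite (B' (ls ! r)) \<and> linked E (B' (ls ! r)) \<and> B' (ls ! r) \<subseteq> V \<and> B' (ls ! r) \<inter> Z = {}"
    if "r < length ls" for r
  proof (intro conjI)
    show "finite (B' (ls ! r))"
      using B(1) R J that by (simp add: B' C_def)
    have "f (X, \<rho> r) \<in> B (ls ! r)"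
      using at[OF that] by blast
    then show "linked E (B' (ls ! r))"
      using linked_Un[of E "B (ls ! r)" "C r" "f (X, \<rho> r)" "f (X, \<rho> r)"] sym B(2) lin start that
      by (simp add: B' C_def)
    show "B' (ls ! r) \<subseteq> V"
      using B(3)[OF that] J[OF that] range_f B'[OF that] by (auto simp: C_def)
    have "f ` R r \<inter> Z = {}"
      using Z(2) R[OF that] by blast
    then show "B' (ls ! r) \<inter> Z = {}"
      using B(4)[OF that] J[OF that] B'[OF that] by (auto simp: C_def)
  qed
  have final: "B' (ls' ! s) \<inter> f ` {p. X' \<le> fst p} = {f (X', \<sigma> s)}" if "s < length ls'" for s
  proof -
    have "s < length ls"
      using that len by simp
    from \<pi>(2)[OF this] obtain r where r: "r < length ls" "s = \<pi> r"
      by (elim exE conjE)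
    have "f (X, \<rho> r) \<notin> f ` {p. X' \<le> fst p}"
      using X' inj_f by (auto dest: injD)
    have "B (ls ! r) \<inter> f ` {p. X' \<le> fst p} = {}"
    proof (rule equals0I)
      fix w
      assume w: "w \<in> B (ls ! r) \<inter> f ` {p. X' \<le> fst p}"
      then have "w \<in> B (ls ! r) \<inter> f ` {p. X \<le> fst p}"
        using image_mono[OF sub, of f] by (simp add: subset_iff)
      then have "w = f (X, \<rho> r)"
        unfolding at[OF r(1)] by simp
      with w \<open>f (X, \<rho> r) \<notin> f ` {p. X' \<le> fst p}\<close> show False
        by simp
    qed
    moreover have "f ` R r \<inter> f ` {p. X' \<le> fst p} = {f (X', \<sigma> s)}"
      using R[OF r(1)] inj_f r(2) by (simp flip: image_Int)
    ultimately show ?thesis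
      using J[OF r(1)] B'[OF r(1)] \<pi>(1)[OF r(1)] r(2) by (auto simp: C_def)
  qed
  have "config Z X' ls' \<sigma> B'"
    unfolding config_def
  proof (intro conjI ballI allI impI)
    show "\<sigma> r < \<sigma> s" if "s < length ls'" "r < s" for r s
      using \<sigma> that len by simp
    show "B' l \<inter> B' l' = {}" if l: "l \<in> set ls'" "l' \<in> set ls'" "l \<noteq> l'" for l l'
    proof -
      obtain r s where "r < length ls" "l = ls ! r" "s < length ls" "l' = ls ! s"
        using l(1,2) unfolding set' by (auto simp: in_set_conv_nth)
      with l(3) B'B'[of r s] show ?thesis
        by blast
    qed
    fix l
    assume "l \<in> set ls'"
    then obtain r where "r < length ls" "l = ls ! r"
      unfolding set' by (auto simp: in_set_conv_nth)
    then show "finite (B' l)" "linked E (B' l)" "B' l \<subseteq> V" "B' l \<inter> Z = {}"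
      using each by simp_all
  qed (use Z Z' X' dist' final in simp_all)
  moreover have "f ` R r \<subseteq> B' (ls ! r)" if "r < length ls" for r
    using B'[OF that] by (auto simp: C_def)
  ultimately show ?thesis
    by (intro exI[of _ B']) (auto simp: B'_def)
qed

definition touching :: "('l \<Rightarrow> 'a set) \<Rightarrow> 'l \<Rightarrow> 'l \<Rightarrow> bool" where
  "touching B l l' \<longleftrightarrow> (\<exists>x\<in>B l. \<exists>y\<in>B l'. E x y)"

lemma touching_mono: "touching B l l' \<Longrightarrow> (\<And>l. B l \<subseteq> B' l) \<Longrightarrow> touching B' l l'"
  unfolding touching_def by blast

lemma touching_sym: "touching B l l' \<Longrightarrow> touching B l' l"
  using sym unfolding touching_def by blast

lemma config_touch:
  assumes conf: "config Z X ls \<rho> B"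
  obtains B' where "config Z (Suc X) ls \<rho> B'" "\<And>l. B l \<subseteq> B' l"
    "\<And>r. Suc r < length ls \<Longrightarrow> touching B' (ls ! r) (ls ! Suc r)"
proof -
  \<comment> \<open>Each rail climbs in column \<open>X\<close> to the row just below the next rail;
    the last one stays in its row.\<close>
  define top where "top r = (if Suc r < length ls then \<rho> (Suc r) - 1 else \<rho> r)" for r
  define R where "R r = hseg X (Suc X) (\<rho> r) \<union> vseg X (\<rho> r) (top r)" for r
  have \<rho>: "\<rho> r < \<rho> s" if "r < s" "s < length ls" for r s
    using conf that by (simp add: config_def)
  have X: "0 < X"
    using conf by (simp add: config_def)
  have le_top: "\<rho> r \<le> top r" for r
    using \<rho>[of r "Suc r"] by (auto simp: top_def)
  have top_less: "top r < \<rho> s" if "r < s" "s < length ls" for r s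
  proof -
    have "\<rho> (Suc r) \<le> \<rho> s"
      using \<rho>[of "Suc r" s] that by (cases "Suc r = s") auto
    moreover have "\<rho> r < \<rho> (Suc r)"
      using \<rho> that by simp
    ultimately show ?thesis
      using that by (simp add: top_def)
  qed
  have "\<exists>B'. config Z (Suc X) ls \<rho> B' \<and> (\<forall>l. B l \<subseteq> B' l) \<and> (\<forall>r<length ls. f ` R r \<subseteq> B' (ls ! r))"
  proof (rule config_extend[OF conf, where \<pi> = "\<lambda>r. r" and J = "\<lambda>_. {}"])
    fix r
    assume "r < length ls"
    have "linked E (f ` R r)"
      unfolding R_def using X le_top by (intro linked_hv) auto
    then show "linked E (f ` R r \<union> {})"
      by simp
    show "finite (R r) \<and> (X, \<rho> r) \<in> R r \<and> R r \<subseteq> {p. X \<le> fst p} \<and> R r \<inter> {p. Suc X \<le> fst p} = {(Suc X, \<rho> r)}"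
      using le_top[of r] by (auto simp: R_def hseg_def vseg_def)
  next
    fix r s
    assume rs: "r < s" "s < length ls"
    have "R r \<inter> R s = {}"
      using \<rho>[OF rs] top_less[OF rs] by (auto simp: R_def)
    then show "(f ` R r \<union> {}) \<inter> (f ` R s \<union> {}) = {}"
      using inj_f by (simp flip: image_Int)
  qed (use \<rho> in auto)
  then obtain B' where B': "config Z (Suc X) ls \<rho> B'" "\<And>l. B l \<subseteq> B' l"
    "\<And>r. r < length ls \<Longrightarrow> f ` R r \<subseteq> B' (ls ! r)"
    by blast
  have "touching B' (ls ! r) (ls ! Suc r)" if "Suc r < length ls" for r
    unfolding touching_def
  proof (intro bexI)
    have lt: "\<rho> r < \<rho> (Suc r)"
      using \<rho> that by simp
    have "adj t A (X, top r) (X, \<rho> (Suc r))"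
      using X lt that by (auto simp: adj_def fwd_def top_def)
    then show "E (f (X, top r)) (f (X, \<rho> (Suc r)))"
      by (rule hom)
    show "f (X, top r) \<in> B' (ls ! r)"
      using B'(3)[of r] that le_top[of r] by (auto simp: R_def)
    show "f (X, \<rho> (Suc r)) \<in> B' (ls ! Suc r)"
      using B'(3)[of "Suc r"] that le_top[of "Suc r"] by (auto simp: R_def)
  qed
  with B' show thesis
    using that by blast
qed

lemma config_add:
  assumes conf: "config Z X ls \<rho> B" and l: "l \<notin> set ls"
  shows "\<exists>\<rho>' B'. config Z X (ls @ [l]) \<rho>' B' \<and> (\<forall>k\<in>set ls. B' k = B k)"
proof -
  let ?m = "length ls"
  \<comment> \<open>A row above all rails: the sum bounds each of its terms.\<close>
  define y where "y = Suc (\<Sum>r<?m. \<rho> r)"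
  define \<rho>' where "\<rho>' = \<rho>(?m := y)"
  define B' where "B' = B(l := {f (X, y)})"
  have less_y: "\<rho> r < y" if "r < ?m" for r
    using member_le_sum[of r "{..<?m}" \<rho>] that by (simp add: y_def)
  have B'[simp]: "B' k = B k" if "k \<in> set ls" for k
    using l that by (auto simp: B'_def)
  have \<rho>: "\<rho> r < \<rho> s" if "r < s" "s < ?m" for r s
    using conf that by (simp add: config_def)
  have at: "B (ls ! r) \<inter> f ` {p. X \<le> fst p} = {f (X, \<rho> r)}" if "r < ?m" for r
    using conf that by (simp add: config_def)
  have new: "f (X, y) \<notin> B k" if k: "k \<in> set ls" for k
  proof
    assume "f (X, y) \<in> B k"
    obtain r where r: "r < ?m" "k = ls ! r"
      using k by (auto simp: in_set_conv_nth)
    have "f (X, y) \<in> {f (X, \<rho> r)}"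
      using at[OF r(1)] \<open>f (X, y) \<in> B k\<close> r(2) by auto
    then show False
      using inj_f less_y[OF r(1)] by (auto dest: injD)
  qed
  have newZ: "f (X, y) \<notin> Z"
    using conf by (auto simp: config_def)
  have "config Z X (ls @ [l]) \<rho>' B'"
    unfolding config_def
  proof (intro conjI allI ballI impI)
    show "\<rho>' r < \<rho>' s" if "s < length (ls @ [l])" "r < s" for r s
      using that \<rho> less_y by (auto simp: \<rho>'_def less_Suc_eq)
    show "B' k \<inter> B' k' = {}" if "k \<in> set (ls @ [l])" "k' \<in> set (ls @ [l])" "k \<noteq> k'" for k k'
    proof -
      have "k \<in> set ls \<Longrightarrow> k' \<in> set ls \<Longrightarrow> B k \<inter> B k' = {}"
        using conf that(3) by (simp add: config_def)
      then show ?thesis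
        using that new by (cases "k = l"; cases "k' = l") (auto simp: B'_def)
    qed
    show "B' ((ls @ [l]) ! r) \<inter> f ` {p. X \<le> fst p} = {f (X, \<rho>' r)}" if "r < length (ls @ [l])" for r
    proof (cases "r < ?m")
      case True
      then show ?thesis
        using at[OF True] by (simp add: nth_append \<rho>'_def)
    next
      case False
      then have "r = ?m"
        using that by simp
      then show ?thesis
        by (simp add: \<rho>'_def B'_def)
    qed
    fix k
    assume "k \<in> set (ls @ [l])"
    then consider "k \<in> set ls" | "k = l"
      by auto
    then have "finite (B' k) \<and> linked E (B' k) \<and> B' k \<subseteq> V \<and> B' k \<inter> Z = {}"
    proof cases
      case 1
      then show ?thesis
        using conf by (simp add: config_def)
    next
      case 2
      then show ?thesis
        using newZ range_f by (auto simp: B'_def linked_singleton)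
    qed
    then show "finite (B' k)" "linked E (B' k)" "B' k \<subseteq> V" "B' k \<inter> Z = {}"
      by simp_all
  qed (use conf l in \<open>simp_all add: config_def\<close>)
  then show ?thesis
    by (intro exI[of _ \<rho>'] exI[of _ B']) auto
qed


text \<open>To the left of a detour at height about \<open>L\<close>, all rails climb to new rows:
  those before \<open>i\<close> pass below the box, those after \<open>Suc i\<close> above it, and
  \<open>i\<close> and \<open>Suc i\<close> enter it at its lower and upper left corners. Behind the
  box every rail follows its row until the detour has ended as well.\<close>

lemma config_swap:
  assumes conf: "config Z X ls \<rho> B" and i: "Suc i < length ls"
  shows "\<exists>X' \<rho>' B'. config Z X' (ls[i := ls ! Suc i, Suc i := ls ! i]) \<rho>' B' \<and> (\<forall>l. B l \<subseteq> B' l)"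
proof -
  define m where "m = length ls"
  \<comment> \<open>A multiple of 4 above all rows in use, with room for three rows per rail below
    the box.\<close>
  define L where "L = 4 * (\<rho> (m - 1) + 3 * m + 10)"
  have \<rho>: "\<rho> r < \<rho> s" if "r < s" "s < m" for r s
    using conf that by (simp add: config_def m_def)
  have \<rho>_le: "\<rho> r \<le> \<rho> (m - 1)" if "r < m" for r
  proof (cases "r < m - 1")
    case True
    then show ?thesis
      using \<rho>[of r "m - 1"] that by simp
  next
    case False
    then have "r = m - 1"
      using that by linarith
    then show ?thesis
      by simp
  qed
  have X: "0 < X" and finite_Z: "finite Z"
    using conf by (simp_all add: config_def)
  define W where "W = Z \<union> \<Union>(B ` set ls)"
  have "finite W"
    using conf by (auto simp: W_def config_def)
  then have "finite (f -` W)"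
    using inj_f by (rule finite_vimageI)
  then have "finite (fst ` (f -` W) \<union> snd ` (f -` W))"
    by simp
  then obtain N where N: "\<forall>k\<in>fst ` (f -` W) \<union> snd ` (f -` W). k < N"
    using finite_nat_set_iff_bounded by blast
  \<comment> \<open>Beyond all lattice vertices used so far and the region where the rails climb, so
    that the detour misses both.\<close>
  define n where "n = N + X + L + 3 * m + 40"
  obtain a b c d u v J where det: "detour a b c d u v J" and a: "n \<le> a + 4"
    and cd: "L - 4 \<le> c" "d \<le> L + 11"
    and JW: "J \<inter> W \<subseteq> range f" and Jn: "J \<inter> f ` ({..n} \<times> {..n}) = {}"
    by (rule ex_detour[of L n W]) (use \<open>finite W\<close> in \<open>auto simp: L_def n_def\<close>)
  have ab: "a < b" and "c < d" and J: "finite J" "card J \<le> 2" "J \<subseteq> V"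
    and Jbox: "J \<inter> f ` ({a..b} \<times> {c..d}) = {}" and Jcd: "\<And>x. f (x, c) \<notin> J" "\<And>x. f (x, d) \<notin> J"
    using det by (auto simp: detour_def)
  have JW0: "J \<inter> W = {}"
  proof (rule equals0I)
    fix w
    assume w: "w \<in> J \<inter> W"
    then obtain x y where xy: "w = f (x, y)"
      using JW by auto
    have "x < N" "y < N"
      using N w unfolding xy by force+
    then have "w \<in> f ` ({..n} \<times> {..n})"
      unfolding xy n_def by (intro imageI) simp
    with w Jn show False
      by blast
  qed
  have Xa: "X + m < a" and "2 \<le> a"
    using a by (simp_all add: n_def)
  obtain P Q J1 J2 where box: "P \<subseteq> {a..b} \<times> {c..d}" "Q \<subseteq> {a..b} \<times> {c..d}" and PQ: "P \<inter> Q = {}"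
    and corners: "(a, c) \<in> P" "(b, d) \<in> P" "(a, d) \<in> Q" "(b, c) \<in> Q"
    and J12: "J1 \<subseteq> J" "J2 \<subseteq> J" "J1 \<inter> J2 = {}"
    and linked_PQ: "linked E (f ` P \<union> J1)" "linked E (f ` Q \<union> J2)"
    using swapper_detour[OF det \<open>2 \<le> a\<close>] unfolding swapper_def by blast
  define rows where "rows = {y. \<exists>x. f (x, y) \<in> J}"
  have rows: "finite rows" "card rows \<le> 2"
    using finite_rows[OF J(1,2)] by (simp_all add: rows_def)
  \<comment> \<open>Three rows are reserved per rail, as \<open>J\<close> may block two of them. For
    \<open>r < i\<close> they lie above all old rows and below the box; the others start at
    \<open>L + 12\<close>, while the box ends at \<open>L + 11\<close> or lower.\<close>
  define base where "base r = (if r < i then \<rho> (m - 1) + 1 + 3 * r else L + 12 + 3 * r)" for r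
  have "\<forall>r. \<exists>y. y \<in> {base r..base r + 2} \<and> y \<notin> rows"
    using ex_avoiding_row[OF rows] by blast
  from choice[OF this] obtain \<tau> where \<tau>: "\<And>r. base r \<le> \<tau> r" "\<And>r. \<tau> r \<le> base r + 2" "\<And>r. \<tau> r \<notin> rows"
    by auto
  define \<sigma> where "\<sigma> r = (if r = i then c else if r = Suc i then d else \<tau> r)" for r
  have \<sigma>_i: "\<sigma> i = c" "\<sigma> (Suc i) = d"
    by (simp_all add: \<sigma>_def)
  have \<sigma>_low: "\<rho> (m - 1) + 1 + 3 * r \<le> \<sigma> r" "\<sigma> r \<le> \<rho> (m - 1) + 3 + 3 * r" "\<sigma> r < c" if "r < i" for r
    using \<tau>(1,2)[of r] that cd(1) i by (auto simp: \<sigma>_def base_def L_def m_def)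
  have \<sigma>_high: "L + 12 + 3 * r \<le> \<sigma> r" "\<sigma> r \<le> L + 14 + 3 * r" "d < \<sigma> r" if "Suc i < r" for r
    using \<tau>(1,2)[of r] that cd(2) by (auto simp: \<sigma>_def base_def)
  have \<sigma>_cases: "r < i \<or> r = i \<or> r = Suc i \<or> Suc i < r" for r
    by linarith
  have \<sigma>: "\<sigma> r < \<sigma> s" if "r < s" "s < m" for r s
    using \<sigma>_cases[of r] \<sigma>_cases[of s] \<sigma>_low[of r] \<sigma>_low[of s] \<sigma>_high[of r] \<sigma>_high[of s] \<sigma>_i
      that \<open>c < d\<close> by (elim disjE) auto
  have \<rho>\<sigma>: "\<rho> r \<le> \<sigma> r" if "r < m" for r
    using \<sigma>_cases[of r] \<sigma>_low[of r] \<sigma>_high[of r] \<sigma>_i \<rho>_le[OF that] cd(1) \<open>c < d\<close> i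
    by (elim disjE) (auto simp: L_def m_def)
  have \<sigma>_n: "\<sigma> r \<le> n" if "r < m" for r
    using \<sigma>_cases[of r] \<sigma>_low[of r] \<sigma>_high[of r] \<sigma>_i cd(2) \<open>c < d\<close> that
    by (elim disjE) (auto simp: n_def L_def)
  have J_row: "f (x, \<sigma> r) \<notin> J" for x r
    using \<tau>(3)[of r] Jcd by (auto simp: \<sigma>_def rows_def)
  have "finite (fst ` (f -` J))"
    using J(1) inj_f by (simp add: finite_vimageI)
  then obtain X0 where X0: "\<forall>k\<in>fst ` (f -` J). k < X0"
    using finite_nat_set_iff_bounded by blast
  define X' where "X' = X0 + b + 1"
  have bX': "b < X'"
    by (simp add: X'_def)
  have JX': "J \<inter> f ` {p. X' \<le> fst p} = {}"
  proof (rule equals0I)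
    fix w
    assume w: "w \<in> J \<inter> f ` {p. X' \<le> fst p}"
    then obtain p where p: "w = f p" "X' \<le> fst p"
      by auto
    then have "fst p < X0"
      using X0 w by blast
    with p show False
      by (simp add: X'_def)
  qed
  define \<pi> where "\<pi> r = (if r = i then Suc i else if r = Suc i then i else r)" for r
  txt \<open>Rail \<open>r\<close> climbs to its new row in column \<open>e r\<close>; upper rails climb first, so that none is crossed.\<close>
  define e where "e r = X + m - r" for r
  have e: "X < e r" "e r \<le> X + m" "e r < a" if "r < m" for r
    using that Xa by (auto simp: e_def)
  have e_less: "e s < e r" if "r < s" "s < m" for r s
    using that by (auto simp: e_def)
  define left where "left r = hseg X (e r) (\<rho> r) \<union> vseg (e r) (\<rho> r) (\<sigma> r)" for r
  define mid where "mid r = hseg (e r) a (\<sigma> r)" for r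
  define far where "far r = (if r = i then P \<union> hseg b X' d else if r = Suc i then Q \<union> hseg b X' c
    else hseg a X' (\<sigma> r))" for r
  define R where "R r = left r \<union> mid r \<union> far r" for r
  define JJ where "JJ r = (if r = i then J1 else if r = Suc i then J2 else {})" for r
  have far_i: "far i = P \<union> hseg b X' d" "far (Suc i) = Q \<union> hseg b X' c"
    "\<And>r. r \<noteq> i \<Longrightarrow> r \<noteq> Suc i \<Longrightarrow> far r = hseg a X' (\<sigma> r)"
    by (simp_all add: far_def)
  have far_a: "a \<le> x" if "(x, y) \<in> far r" for x y r
    using that box ab by (auto simp: far_def split: if_splits)
  have a_far: "(a, \<sigma> r) \<in> far r" for r
    using corners ab bX' by (auto simp: far_def \<sigma>_def)
  have far_end: "far r \<inter> {p. X' \<le> fst p} = {(X', \<sigma> (\<pi> r))}" for r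
  proof -
    consider "r = i" | "r = Suc i" | "r \<noteq> i" "r \<noteq> Suc i"
      by blast
    then show ?thesis
    proof cases
      case 1
      then show ?thesis
        using box bX' by (auto simp: far_i \<pi>_def \<sigma>_i hseg_def)
    next
      case 2
      then show ?thesis
        using box bX' by (auto simp: far_i \<pi>_def \<sigma>_i hseg_def)
    next
      case 3
      then show ?thesis
        using ab bX' by (auto simp: far_i \<pi>_def hseg_def)
    qed
  qed
  have far_disjoint: "far r \<inter> far s = {}" if "r < s" "s < m" for r s
  proof -
    have mixed: "hseg a X' (\<sigma> r) \<inter> (far i \<union> far (Suc i)) = {}" if "r \<noteq> i" "r \<noteq> Suc i" for r
      using \<sigma>_cases[of r] \<sigma>_low(3)[of r] \<sigma>_high(3)[of r] that box \<open>c < d\<close> by (auto simp: far_i)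
    have swapped: "far i \<inter> far (Suc i) = {}"
    proof -
      have "P \<inter> hseg b X' c \<subseteq> {(b, c)}" "Q \<inter> hseg b X' d \<subseteq> {(b, d)}"
        using box by auto
      moreover have "(b, c) \<notin> P" "(b, d) \<notin> Q"
        using PQ corners by blast+
      moreover have "hseg b X' d \<inter> hseg b X' c = {}"
        using \<open>c < d\<close> by auto
      ultimately show ?thesis
        using PQ unfolding far_i by blast
    qed
    show ?thesis
      using mixed[of r] mixed[of s] swapped \<sigma>[OF that] that
      by (cases "r = i \<or> r = Suc i"; cases "s = i \<or> s = Suc i") (auto simp: far_i(3))
  qed
  have R_disjoint: "R r \<inter> R s = {}" if "r < s" "s < m" for r s
  proof -
    have r: "r < m"
      using that by simp
    have "left r \<inter> left s = {}" "left r \<inter> mid s = {}" "mid r \<inter> left s = {}" "mid r \<inter> mid s = {}"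
      using \<rho>[OF that] \<sigma>[OF that] e_less[OF that] \<rho>\<sigma>[OF r] \<rho>\<sigma>[OF that(2)]
      by (auto simp: left_def mid_def)
    moreover have "left r \<inter> far s = {}" "far r \<inter> left s = {}"
      using far_a e(3)[OF r] e(3)[OF that(2)] by (fastforce simp: left_def)+
    moreover have "mid r \<inter> far s = {}" "far r \<inter> mid s = {}"
    proof -
      have "mid q \<inter> far q' \<subseteq> far q \<inter> far q'" for q q'
      proof
        fix p
        assume p: "p \<in> mid q \<inter> far q'"
        then have "p = (a, \<sigma> q)"
          using far_a[of "fst p" "snd p" q'] by (auto simp: mid_def hseg_def)
        with p a_far show "p \<in> far q \<inter> far q'"
          by simp
      qed
      then show "mid r \<inter> far s = {}" "far r \<inter> mid s = {}"
        using far_disjoint[OF that] by blast+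
    qed
    ultimately show ?thesis
      using far_disjoint[OF that] unfolding R_def by blast
  qed
  \<comment> \<open>The reason differs from part to part: climbing stays in
    \<open>{..n} \<times> {..n}\<close>, the rows followed are free of \<open>J\<close>, and
    \<open>J\<close> misses the box.\<close>
  have R_J: "f ` R r \<inter> J = {}" if "r < m" for r
  proof (rule equals0I)
    fix w
    assume w: "w \<in> f ` R r \<inter> J"
    then obtain x y where xy: "(x, y) \<in> R r" "w = f (x, y)"
      by auto
    have "(x, y) \<in> {..n} \<times> {..n}" if "(x, y) \<in> left r"
      using that e(2)[OF \<open>r < m\<close>] \<rho>\<sigma>[OF \<open>r < m\<close>] \<sigma>_n[OF \<open>r < m\<close>] by (auto simp: left_def n_def)
    moreover have "y = \<sigma> r" if "(x, y) \<in> mid r"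
      using that by (simp add: mid_def)
    moreover have "(x, y) \<in> P \<union> Q \<or> y = \<sigma> r \<or> y = c \<or> y = d" if "(x, y) \<in> far r"
      using that by (auto simp: far_def split: if_splits)
    ultimately have "f (x, y) \<in> f ` ({..n} \<times> {..n}) \<or> y = \<sigma> r \<or> y = c \<or> y = d \<or> f (x, y) \<in> f ` ({a..b} \<times> {c..d})"
      using xy(1) box unfolding R_def by blast
    moreover have "f (x, y) \<in> J"
      using w xy(2) by simp
    ultimately show False
      using Jn Jbox J_row[of x r] Jcd[of x] by blast
  qed
  have lin: "linked E (f ` R r \<union> JJ r)" if "r < m" for r
  proof -
    have near: "linked E (f ` (left r \<union> mid r))"
    proof (rule linked_join[of _ _ "(e r, \<sigma> r)"])
      show "linked E (f ` left r)"
        unfolding left_def using X e(1)[OF that] \<rho>\<sigma>[OF that] by (intro linked_hv) auto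
      show "linked E (f ` mid r)"
        unfolding mid_def using e[OF that] by (intro linked_hseg) auto
    qed (use \<rho>\<sigma>[OF that] e[OF that] in \<open>auto simp: left_def mid_def\<close>)
    have away: "linked E (f ` far r \<union> JJ r)"
    proof -
      consider "r = i" | "r = Suc i" | "r \<noteq> i" "r \<noteq> Suc i"
        by blast
      then show ?thesis
      proof cases
        case 1
        have "linked E ((f ` P \<union> J1) \<union> f ` hseg b X' d)"
          by (rule linked_Un[where a = "f (b, d)" and b = "f (b, d)", OF _ linked_PQ(1) linked_hseg])
            (use sym ab bX' corners in auto)
        then show ?thesis
          using 1 by (simp add: far_i JJ_def image_Un Un_ac)
      next
        case 2
        have "linked E ((f ` Q \<union> J2) \<union> f ` hseg b X' c)"
          by (rule linked_Un[where a = "f (b, c)" and b = "f (b, c)", OF _ linked_PQ(2) linked_hseg])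
            (use sym ab bX' corners in auto)
        then show ?thesis
          using 2 by (simp add: far_i JJ_def image_Un Un_ac)
      next
        case 3
        then show ?thesis
          using linked_hseg[of a X' "\<sigma> r"] \<open>2 \<le> a\<close> ab bX' by (simp add: far_i JJ_def)
      qed
    qed
    have "linked E (f ` (left r \<union> mid r) \<union> (f ` far r \<union> JJ r))"
      by (rule linked_Un[where a = "f (a, \<sigma> r)" and b = "f (a, \<sigma> r)", OF _ near away])
        (use sym a_far[of r] e[OF that] in \<open>auto simp: mid_def\<close>)
    then show ?thesis
      by (simp add: R_def image_Un Un_ac)
  qed
  have "\<exists>B'. config Z X' (ls[i := ls ! Suc i, Suc i := ls ! i]) \<sigma> B' \<and> (\<forall>l. B l \<subseteq> B' l) \<and>
      (\<forall>r<length ls. f ` R r \<subseteq> B' (ls ! r))"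
  proof (rule config_extend[OF conf, where \<pi> = \<pi> and J = JJ])
    show "X < X'"
      using Xa ab bX' by simp
    show "length (ls[i := ls ! Suc i, Suc i := ls ! i]) = length ls"
      by simp
    show "\<pi> r < length ls \<and> ls[i := ls ! Suc i, Suc i := ls ! i] ! \<pi> r = ls ! r" if "r < length ls" for r
      using that i by (auto simp: \<pi>_def nth_list_update)
    show "\<exists>r<length ls. s = \<pi> r" if "s < length ls" for s
      using that i by (intro exI[of _ "\<pi> s"]) (auto simp: \<pi>_def)
    show "\<sigma> r < \<sigma> s" if "r < s" "s < length ls" for r s
      using \<sigma> that by (simp add: m_def)
    fix r
    assume "r < length ls"
    then have r: "r < m"
      by (simp add: m_def)
    show "linked E (f ` R r \<union> JJ r)"
      by (rule lin[OF r])
    have "finite (far r)"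
      using box by (auto simp: far_def hseg_def intro: finite_subset)
    then have "finite (R r)"
      by (simp add: R_def left_def mid_def hseg_def vseg_def)
    moreover have "(X, \<rho> r) \<in> R r"
      using e(1)[OF r] by (simp add: R_def left_def)
    moreover have "R r \<subseteq> {p. X \<le> fst p}"
      using e(1,3)[OF r] far_a by (fastforce simp: R_def left_def mid_def)
    moreover have "(left r \<union> mid r) \<inter> {p. X' \<le> fst p} = {}"
      using e(3)[OF r] ab bX' by (auto simp: left_def mid_def hseg_def vseg_def)
    then have "R r \<inter> {p. X' \<le> fst p} = {(X', \<sigma> (\<pi> r))}"
      using far_end[of r] by (simp add: R_def Int_Un_distrib2)
    ultimately show "finite (R r) \<and> (X, \<rho> r) \<in> R r \<and> R r \<subseteq> {p. X \<le> fst p} \<and>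
        R r \<inter> {p. X' \<le> fst p} = {(X', \<sigma> (\<pi> r))}"
      by blast
    have "JJ r \<subseteq> J"
      using J12 by (simp add: JJ_def)
    then have "JJ r \<inter> W = {}" "JJ r \<inter> f ` {p. X' \<le> fst p} = {}" "JJ r \<subseteq> V" "finite (JJ r)"
      using JW0 JX' J(3) finite_subset[OF _ J(1)] by auto
    moreover from this(1) have "JJ r \<inter> Z = {}" "\<forall>l\<in>set ls. JJ r \<inter> B l = {}"
      by (auto simp: W_def)
    ultimately show "finite (JJ r) \<and> JJ r \<subseteq> V \<and> JJ r \<inter> Z = {} \<and> (\<forall>l\<in>set ls. JJ r \<inter> B l = {}) \<and>
        JJ r \<inter> f ` {p. X' \<le> fst p} = {}"
      by simp
  next
    fix r s
    assume "r < s" "s < length ls"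
    then have rs: "r < s" "s < m" "r < m"
      by (simp_all add: m_def)
    have "f ` R r \<inter> f ` R s = {}"
      using R_disjoint[OF rs(1,2)] inj_f by (simp flip: image_Int)
    moreover have "JJ r \<subseteq> J" "JJ s \<subseteq> J" "JJ r \<inter> JJ s = {}"
      using J12 rs(1) by (auto simp: JJ_def)
    moreover have "(S \<union> K) \<inter> (T \<union> M) = {}"
      if "S \<inter> T = {}" "K \<subseteq> J" "M \<subseteq> J" "K \<inter> M = {}" "S \<inter> J = {}" "T \<inter> J = {}" for S K T M
      using that by blast
    ultimately show "(f ` R r \<union> JJ r) \<inter> (f ` R s \<union> JJ s) = {}"
      using R_J[OF rs(3)] R_J[OF rs(2)] by simp
  qed
  then show ?thesis
    by blast
qed

end

section \<open>From linked sets to paths with distinct vertices\<close>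

lemma graph_path_append1: "graph_path E (xs @ ys) \<Longrightarrow> xs \<noteq> [] \<Longrightarrow> graph_path E xs"
  unfolding graph_path_def
proof (elim conjE, intro conjI allI impI)
  fix i
  assume *: "\<forall>i. Suc i < length (xs @ ys) \<longrightarrow> E ((xs @ ys) ! i) ((xs @ ys) ! Suc i)" and i: "Suc i < length xs"
  show "E (xs ! i) (xs ! Suc i)"
    using *[rule_format, of i] i by (simp add: nth_append)
qed auto

lemma graph_path_snoc:
  assumes "graph_path E xs" and "E (last xs) z" and "z \<notin> set xs"
  shows "graph_path E (xs @ [z])"
  unfolding graph_path_def
proof (intro conjI allI impI)
  fix i
  assume i: "Suc i < length (xs @ [z])"
  show "E ((xs @ [z]) ! i) ((xs @ [z]) ! Suc i)"
  proof (cases "Suc i < length xs")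
    case True
    then show ?thesis
      using assms(1) by (simp add: graph_path_def nth_append)
  next
    case False
    then have "length xs = Suc i"
      using i by simp
    moreover from this have "xs ! i = last xs"
      by (metis diff_Suc_1 last_conv_nth length_0_conv nat.distinct(1))
    ultimately show ?thesis
      using assms(2) by (simp add: nth_append)
  qed
qed (use assms in \<open>auto simp: graph_path_def\<close>)

lemma linked_imp_path:
  assumes "linked E S" and "x \<in> S" and "y \<in> S"
  shows "\<exists>xs. graph_path E xs \<and> hd xs = x \<and> last xs = y \<and> set xs \<subseteq> S"
proof -
  have "(\<lambda>a b. a \<in> S \<and> b \<in> S \<and> E a b)\<^sup>*\<^sup>* x y"
    using assms by (simp add: linked_def)
  then show ?thesis
  proof (induction rule: rtranclp_induct)
    case base
    show ?case
      using assms(2) by (intro exI[of _ "[x]"]) (simp add: graph_path_def)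
  next
    case (step y z)
    then obtain xs where xs: "graph_path E xs" "hd xs = x" "last xs = y" "set xs \<subseteq> S"
      by blast
    have ne: "xs \<noteq> []"
      using xs(1) by (simp add: graph_path_def)
    show ?case
    proof (cases "z \<in> set xs")
      case True
      \<comment> \<open>A path that already visits \<open>z\<close> is cut off there, since
        \<open>graph_path\<close> demands distinct vertices.\<close>
      then obtain ys zs where eq: "xs = ys @ z # zs"
        by (meson split_list)
      then have "graph_path E (ys @ [z])"
        using graph_path_append1[of E "ys @ [z]" zs] xs(1) by simp
      moreover have "hd (ys @ [z]) = x"
        using xs(2) unfolding eq by (cases ys) auto
      ultimately show ?thesis
        using xs(4) eq by (intro exI[of _ "ys @ [z]"]) auto
    next
      case False
      then show ?thesis
        using graph_path_snoc[of E xs z] xs step(2) ne by (intro exI[of _ "xs @ [z]"]) auto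
    qed
  qed
qed

section \<open>Making rails pairwise adjacent; the minor and the subdivision\<close>

context embedded_lattice
begin

text \<open>Exchanging \<open>l\<close> with the rails of \<open>as\<close> one at a time makes it a
  neighbour of each. \<open>config_touch\<close> secures the contact before every exchange, and it
  persists because the sets only grow.\<close>

lemma config_front:
  assumes "config Z X (as @ l # bs) \<rho> B"
  shows "\<exists>X' \<rho>' B'. config Z X' (l # as @ bs) \<rho>' B' \<and> (\<forall>k. B k \<subseteq> B' k) \<and>
    (\<forall>k\<in>set as. touching B' k l)"
  using assms
proof (induction as arbitrary: X bs \<rho> B rule: rev_induct)
  case Nil
  then show ?case
    by auto
next
  case (snoc a as)
  obtain B1 where B1: "config Z (Suc X) ((as @ [a]) @ l # bs) \<rho> B1" "\<And>k. B k \<subseteq> B1 k"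
    "\<And>r. Suc r < length ((as @ [a]) @ l # bs) \<Longrightarrow>
      touching B1 (((as @ [a]) @ l # bs) ! r) (((as @ [a]) @ l # bs) ! Suc r)"
    using config_touch[OF snoc.prems] by metis
  have t: "touching B1 a l"
    using B1(3)[of "length as"] by (simp add: nth_append)
  obtain X2 \<rho>2 B2 where "config Z X2 (((as @ [a]) @ l # bs)[length as := ((as @ [a]) @ l # bs) ! Suc (length as),
      Suc (length as) := ((as @ [a]) @ l # bs) ! length as]) \<rho>2 B2" and B2: "\<And>k. B1 k \<subseteq> B2 k"
    using config_swap[OF B1(1), of "length as"] by auto
  then have "config Z X2 (as @ l # (a # bs)) \<rho>2 B2"
    by (simp add: nth_append list_update_append)
  from snoc.IH[OF this] obtain X3 \<rho>3 B3 where B3: "config Z X3 (l # as @ a # bs) \<rho>3 B3"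
    "\<And>k. B2 k \<subseteq> B3 k" "\<And>k. k \<in> set as \<Longrightarrow> touching B3 k l"
    by blast
  have B13: "B1 k \<subseteq> B3 k" for k
    using B2 B3(2) by (rule order_trans)
  then have "B k \<subseteq> B3 k" for k
    using B1(2) by (rule order_trans[rotated])
  moreover have "touching B3 a l"
    using touching_mono[OF t] B13 by blast
  ultimately show ?case
    using B3 by (intro exI[of _ X3] exI[of _ \<rho>3] exI[of _ B3]) simp
qed

text \<open>Each further rail is led down past all earlier ones, which already touch each other; the
  rails of \<open>bs\<close> wait above. Only the set of \<open>as'\<close> is recorded, as this
  reorders the rails.\<close>

lemma config_all_touching:
  assumes "config Z X (as @ bs) \<rho> B"
  shows "\<exists>X' \<rho>' B' as'. config Z X' (as' @ bs) \<rho>' B' \<and> (\<forall>k. B k \<subseteq> B' k) \<and> set as' = set as \<and>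
    (\<forall>k\<in>set as. \<forall>k'\<in>set as. k \<noteq> k' \<longrightarrow> touching B' k k')"
  using assms
proof (induction as arbitrary: bs rule: rev_induct)
  case Nil
  then show ?case
    by (intro exI[of _ X] exI[of _ \<rho>] exI[of _ B] exI[of _ "[]"]) simp
next
  case (snoc l as)
  then have "config Z X (as @ l # bs) \<rho> B"
    by simp
  from snoc.IH[OF this] obtain X1 \<rho>1 B1 as1 where *: "config Z X1 (as1 @ l # bs) \<rho>1 B1 \<and>
      (\<forall>k. B k \<subseteq> B1 k) \<and> set as1 = set as \<and>
      (\<forall>k\<in>set as. \<forall>k'\<in>set as. k \<noteq> k' \<longrightarrow> touching B1 k k')"
    by (elim exE)
  then have 1: "config Z X1 (as1 @ l # bs) \<rho>1 B1" "\<And>k. B k \<subseteq> B1 k" "set as1 = set as"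
    "\<And>k k'. k \<in> set as \<Longrightarrow> k' \<in> set as \<Longrightarrow> k \<noteq> k' \<Longrightarrow> touching B1 k k'"
    by simp_all
  from config_front[OF 1(1)] obtain X2 \<rho>2 B2 where "config Z X2 (l # as1 @ bs) \<rho>2 B2 \<and>
      (\<forall>k. B1 k \<subseteq> B2 k) \<and> (\<forall>k\<in>set as1. touching B2 k l)"
    by (elim exE)
  then have 2: "config Z X2 (l # as1 @ bs) \<rho>2 B2" "\<And>k. B1 k \<subseteq> B2 k" "\<And>k. k \<in> set as \<Longrightarrow> touching B2 k l"
    by (simp_all add: 1(3))
  have "B k \<subseteq> B2 k" for k
    using 1(2) 2(2) by (rule order_trans)
  moreover have "touching B2 k k'" if "k \<in> set (as @ [l])" "k' \<in> set (as @ [l])" "k \<noteq> k'" for k k'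
  proof -
    have old: "touching B2 k k'" if "k \<in> set as" "k' \<in> set as" "k \<noteq> k'" for k k'
      using touching_mono[OF 1(4)[OF that]] 2(2) by blast
    consider "k \<in> set as" "k' \<in> set as" | "k \<in> set as" "k' = l" | "k = l" "k' \<in> set as"
      using \<open>k \<in> set (as @ [l])\<close> \<open>k' \<in> set (as @ [l])\<close> \<open>k \<noteq> k'\<close> by auto
    then show ?thesis
    proof cases
      case 1
      then show ?thesis
        using old \<open>k \<noteq> k'\<close> by blast
    next
      case k: 2
      then show ?thesis
        using 2(3) by simp
    next
      case 3
      then show ?thesis
        using touching_sym[OF 2(3)] by simp
    qed
  qed
  ultimately show ?case
    using 2(1) 1(3) by (intro exI[of _ X2] exI[of _ \<rho>2] exI[of _ B2] exI[of _ "l # as1"]) simp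
qed

lemma config_memD:
  assumes "config Z X ls \<rho> B" and "l \<in> set ls"
  shows "B l \<noteq> {}" "linked E (B l)" "B l \<subseteq> V" "B l \<inter> Z = {}"
    "\<And>l'. l' \<in> set ls \<Longrightarrow> l \<noteq> l' \<Longrightarrow> B l \<inter> B l' = {}"
proof -
  obtain r where "r < length ls" "l = ls ! r"
    using assms(2) by (auto simp: in_set_conv_nth)
  then have "B l \<inter> f ` {p. X \<le> fst p} = {f (X, \<rho> r)}"
    using assms(1) by (simp add: config_def)
  then show "B l \<noteq> {}"
    by auto
qed (use assms in \<open>simp_all add: config_def\<close>)

text \<open>Every stage adds one rail and leads it past all others. The branch sets are the unions
  over the stages; they are disjoint and connected because any two vertices occur at a common
  stage.\<close>

lemma K_aleph0_minor: "has_K_aleph0_minor V E"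
proof -
  \<comment> \<open>The order is reversed because rail \<open>n\<close> is added on top and
    \<open>config_front\<close> takes it to the bottom.\<close>
  define P where "P n s \<longleftrightarrow> (case s of (X, \<rho>, B) \<Rightarrow> config {} X (rev [0..<n]) \<rho> B \<and>
    (\<forall>i<n. \<forall>j<n. i \<noteq> j \<longrightarrow> touching B i j))" for n and s :: "nat \<times> (nat \<Rightarrow> nat) \<times> (nat \<Rightarrow> 'a set)"
  have "\<exists>s. \<forall>n. P n (s n) \<and> (\<forall>i<n. snd (snd (s n)) i \<subseteq> snd (snd (s (Suc n))) i)"
  proof (rule dependent_nat_choice)
    have "P 0 (1, \<lambda>_. 0, \<lambda>_. {})"
      by (simp add: P_def config_def)
    then show "\<exists>s. P 0 s"
      by blast
  next
    fix s n
    assume "P n s"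
    then obtain X \<rho> B where s: "s = (X, \<rho>, B)" and conf: "config {} X (rev [0..<n]) \<rho> B"
      and tch: "\<And>i j. i < n \<Longrightarrow> j < n \<Longrightarrow> i \<noteq> j \<Longrightarrow> touching B i j"
      unfolding P_def by (cases s) auto
    obtain \<rho>1 B1 where 1: "config {} X (rev [0..<n] @ [n]) \<rho>1 B1" "\<And>k. k < n \<Longrightarrow> B1 k = B k"
      using config_add[OF conf, of n] by auto
    from config_front[OF 1(1)] obtain X2 \<rho>2 B2 where 2: "config {} X2 (n # rev [0..<n] @ []) \<rho>2 B2"
      "\<And>k. B1 k \<subseteq> B2 k" "\<And>k. k < n \<Longrightarrow> touching B2 k n"
      by auto
    have old: "touching B2 i j" if "i < n" "j < n" "i \<noteq> j" for i j
    proof -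
      have "touching B1 i j"
        using tch[OF that] that 1(2) by (simp add: touching_def)
      then show ?thesis
        by (rule touching_mono) (rule 2(2))
    qed
    have "touching B2 i j" if "i < Suc n" "j < Suc n" "i \<noteq> j" for i j
    proof -
      consider "i < n" "j < n" | "i < n" "j = n" | "i = n" "j < n"
        using \<open>i < Suc n\<close> \<open>j < Suc n\<close> \<open>i \<noteq> j\<close> by (auto simp: less_Suc_eq)
      then show ?thesis
        using old \<open>i \<noteq> j\<close> 2(3) touching_sym[OF 2(3)] by cases simp_all
    qed
    then have "P (Suc n) (X2, \<rho>2, B2)"
      using 2(1) by (simp add: P_def)
    moreover have "\<forall>i<n. snd (snd s) i \<subseteq> B2 i"
      using 1(2) 2(2) s by auto
    ultimately show "\<exists>s'. P (Suc n) s' \<and> (\<forall>i<n. snd (snd s) i \<subseteq> snd (snd s') i)"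
      by (intro exI[of _ "(X2, \<rho>2, B2)"]) simp
  qed
  then obtain s where s: "\<And>n. P n (s n)" "\<And>n i. i < n \<Longrightarrow> snd (snd (s n)) i \<subseteq> snd (snd (s (Suc n))) i"
    by blast
  define B where "B n = snd (snd (s n))" for n
  have conf: "\<exists>X \<rho>. config {} X (rev [0..<n]) \<rho> (B n)" for n
    using s(1)[of n] unfolding P_def B_def by (cases "s n") auto
  have tch: "touching (B n) i j" if "i < n" "j < n" "i \<noteq> j" for n i j
    using s(1)[of n] that by (auto simp: P_def B_def)
  have memD: "B n i \<noteq> {}" "linked E (B n i)" "B n i \<subseteq> V" if "i < n" for n i
  proof -
    obtain X \<rho> where c: "config {} X (rev [0..<n]) \<rho> (B n)"
      using conf by blast
    have i: "i \<in> set (rev [0..<n])"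
      using that by simp
    show "B n i \<noteq> {}" "linked E (B n i)" "B n i \<subseteq> V"
      by (rule config_memD[OF c i])+
  qed
  have disj: "B n i \<inter> B n j = {}" if "i < n" "j < n" "i \<noteq> j" for n i j
  proof -
    obtain X \<rho> where c: "config {} X (rev [0..<n]) \<rho> (B n)"
      using conf by blast
    have "i \<in> set (rev [0..<n])" "j \<in> set (rev [0..<n])"
      using that by simp_all
    then show ?thesis
      using config_memD(5)[OF c] that(3) by simp
  qed
  have mono: "B n i \<subseteq> B n' i" if "i < n" "n \<le> n'" for n n' i
    using that(2)
  proof (induction n' rule: dec_induct)
    case (step k)
    then have "B k i \<subseteq> B (Suc k) i"
      using s(2)[of i k] that(1) by (simp add: B_def)
    with step show ?case
      by simp
  qed simp
  \<comment> \<open>Only stages \<open>n > i\<close> count, as \<open>i\<close> is not a rail before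
    and the value of \<open>B n i\<close> is then uncontrolled.\<close>
  define M where "M i = (\<Union>n\<in>{i<..}. B n i)" for i
  have in_M: "B n i \<subseteq> M i" if "i < n" for n i
    using that by (auto simp: M_def)
  show ?thesis
    unfolding has_K_aleph0_minor_def
  proof (intro exI[of _ M] conjI allI impI)
    fix i
    show "M i \<noteq> {}"
      using in_M[of i "Suc i"] memD(1)[of i "Suc i"] by auto
    show "M i \<subseteq> V"
      using memD(3) by (auto simp: M_def)
    show "connected_set E (M i)"
      unfolding connected_set_def
    proof (intro ballI)
      fix x y
      assume "x \<in> M i" "y \<in> M i"
      then obtain n n' where n: "i < n" "x \<in> B n i" "i < n'" "y \<in> B n' i"
        by (auto simp: M_def)
      have "x \<in> B (max n n') i" "y \<in> B (max n n') i"
        using mono[of i n "max n n'"] mono[of i n' "max n n'"] n by auto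
      moreover have lt: "i < max n n'"
        using n(1) by simp
      ultimately obtain xs where "graph_path E xs" "hd xs = x" "last xs = y" "set xs \<subseteq> B (max n n') i"
        using linked_imp_path[OF memD(2)[OF lt]] by blast
      then show "\<exists>xs. graph_path E xs \<and> hd xs = x \<and> last xs = y \<and> set xs \<subseteq> M i"
        using in_M[OF lt] by (intro exI[of _ xs]) simp
    qed
    fix j :: nat
    assume ij: "i \<noteq> j"
    show "M i \<inter> M j = {}"
    proof (rule equals0I)
      fix x
      assume "x \<in> M i \<inter> M j"
      then obtain n n' where n: "i < n" "x \<in> B n i" "j < n'" "x \<in> B n' j"
        by (auto simp: M_def)
      have "x \<in> B (max n n') i \<inter> B (max n n') j"
        using mono[of i n "max n n'"] mono[of j n' "max n n'"] n by auto
      then show False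
        using disj[of i "max n n'" j] ij n by simp
    qed
    show "\<exists>x\<in>M i. \<exists>y\<in>M j. E x y"
      using tch[of i "Suc (max i j)" j] ij in_M[of i "Suc (max i j)"] in_M[of j "Suc (max i j)"]
      unfolding touching_def by (meson less_Suc_eq_le max.cobounded1 max.cobounded2 subsetD)
  qed
qed

text \<open>Rail \<open>(i, j)\<close> starts next to hub \<open>i\<close> and is reserved for the
  path between hubs \<open>i\<close> and \<open>j\<close>: it runs through rail
  \<open>(i, j)\<close>, crosses over by a contact to rail \<open>(j, i)\<close> and ends at hub
  \<open>j\<close>. Taking the hubs as \<open>Z\<close> keeps rails and detours away from the branch
  vertices.\<close>

lemma subdivided_K: "has_subdivided_K V E t"
proof -
  define b where "b j = f (0, j)" for j
  define B0 where "B0 = (\<lambda>(j, l). {f (1, j * t + l)})"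
  let ?ls = "List.product [0..<t] [0..<t]"
  have nth: "?ls ! r = (r div t, r mod t)" if "r < t * t" for r
  proof -
    have "0 < t"
      using that by (cases t) auto
    then have "r div t < t" "r mod t < t"
      using that by (simp_all add: less_mult_imp_div_less)
    then show ?thesis
      using product_nth[of r "[0..<t]" "[0..<t]"] that by simp
  qed
  have inj_label: "(j, l) = (j', l')" if "j * t + l = j' * t + l'" "l < t" "l' < t" for j l j' l'
  proof -
    have "j = j'"
      using arg_cong[OF that(1), of "\<lambda>x. x div t"] that(2,3) by simp
    then show ?thesis
      using that(1) by simp
  qed
  \<comment> \<open>\<open>List.product\<close> has the label \<open>(j, l)\<close> at position
    \<open>j * t + l\<close>, which is also the row where this rail starts; hence the rows are given
    by the identity.\<close>
  have "config (b ` {..<t}) 1 (?ls @ []) (\<lambda>r. r) B0"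
    unfolding config_def
  proof (intro conjI allI ballI impI)
    show "b ` {..<t} \<inter> f ` {p. 1 \<le> fst p} = {}"
      using inj_f by (auto simp: b_def dest: injD)
    show "distinct (?ls @ [])"
      by (simp add: distinct_product)
    show "B0 l \<inter> B0 l' = {}" if "l \<in> set (?ls @ [])" "l' \<in> set (?ls @ [])" "l \<noteq> l'" for l l'
    proof -
      obtain i j i' j' where l: "l = (i, j)" "l' = (i', j')"
        by (metis surj_pair)
      then have "j < t" "j' < t"
        using that by simp_all
      then have "i * t + j \<noteq> i' * t + j'"
        using inj_label[of i j i' j'] that(3) l by blast
      then have "f (1, i * t + j) \<noteq> f (1, i' * t + j')"
        using inj_f by (simp add: inj_eq)
      then show ?thesis
        by (simp add: B0_def l)
    qed
    show "B0 ((?ls @ []) ! r) \<inter> f ` {p. 1 \<le> fst p} = {f (1, r)}" if "r < length (?ls @ [])" for r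
    proof -
      have "r < t * t"
        using that by simp
      then have "B0 ((?ls @ []) ! r) = {f (1, r)}"
        using nth by (simp add: B0_def)
      then show ?thesis
        by simp
    qed
    fix l
    show "finite (B0 l)" "linked E (B0 l)" "B0 l \<subseteq> V"
      using range_f by (auto simp: B0_def linked_singleton split: prod.split)
    show "B0 l \<inter> b ` {..<t} = {}"
      using inj_f by (auto simp: B0_def b_def dest: injD split: prod.split)
  qed auto
  from config_all_touching[OF this] obtain X \<rho> B ls where conf: "config (b ` {..<t}) X ls \<rho> B"
    and B0: "\<And>k. B0 k \<subseteq> B k" and ls: "set ls = set ?ls"
    and tch: "\<And>k k'. k \<in> set ?ls \<Longrightarrow> k' \<in> set ?ls \<Longrightarrow> k \<noteq> k' \<Longrightarrow> touching B k k'"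
    by auto
  have mem: "(i, j) \<in> set ls" if "i < t" "j < t" for i j
    using that ls by simp
  have B_b: "B (i, j) \<inter> b ` {..<t} = {}" if "i < t" "j < t" for i j
    using config_memD(4)[OF conf mem] that by blast
  define S where "S i j = insert (b i) (B (i, j)) \<union> insert (b j) (B (j, i))" for i j
  have half: "linked E (insert (b i) (B (i, j)))" if "i < t" "j < t" for i j
  proof (rule linked_insert[OF sym])
    show "linked E (B (i, j))"
      using config_memD(2)[OF conf mem] that by blast
    show "f (1, i * t + j) \<in> B (i, j)"
      using B0[of "(i, j)"] by (simp add: B0_def)
    have "adj t A (0, i) (1, i * t + j)"
      using that by (simp add: adj_def fwd_def)
    then show "E (b i) (f (1, i * t + j))"
      unfolding b_def by (rule hom)
  qed
  have S: "linked E (S i j)" if ij: "i < t" "j < t" "i \<noteq> j" for i j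
  proof -
    have "touching B (i, j) (j, i)"
      using tch ij by simp
    then obtain x y where xy: "x \<in> B (i, j)" "y \<in> B (j, i)" "E x y"
      unfolding touching_def by blast
    show ?thesis
      unfolding S_def
      by (rule linked_Un[where a = x and b = y, OF _ half[OF ij(1,2)] half[OF ij(2,1)]]) (use sym xy in auto)
  qed
  have "\<exists>xs. i < t \<and> j < t \<and> i \<noteq> j \<longrightarrow>
      graph_path E xs \<and> hd xs = b i \<and> last xs = b j \<and> set xs \<subseteq> S i j" for i j
    using linked_imp_path[OF S, of i j "b i" "b j"] by (auto simp: S_def)
  then obtain P where P: "\<And>i j. i < t \<Longrightarrow> j < t \<Longrightarrow> i \<noteq> j \<Longrightarrow>
      graph_path E (P i j) \<and> hd (P i j) = b i \<and> last (P i j) = b j \<and> set (P i j) \<subseteq> S i j"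
    by metis
  have b_V: "b i \<in> V" for i
    using range_f by (auto simp: b_def)
  have S_V: "S i j \<subseteq> V" if "i < t" "j < t" for i j
    using b_V config_memD(3)[OF conf mem] that by (simp add: S_def)
  have S_sub: "S i j \<subseteq> {b i, b j} \<union> (B (i, j) \<union> B (j, i))" for i j
    by (auto simp: S_def)
  show ?thesis
    unfolding has_subdivided_K_def
  proof (intro exI[of _ b] exI[of _ P] conjI allI impI)
    show "inj_on b {..<t}"
      using inj_f by (auto simp: inj_on_def b_def dest: injD)
    show "b ` {..<t} \<subseteq> V"
      using b_V by blast
    fix i j
    {
      assume "i < j \<and> j < t"
      then have ij: "i < t" "j < t" "i \<noteq> j"
        by auto
      note P = P[OF ij]
      show "graph_path E (P i j)" "hd (P i j) = b i" "last (P i j) = b j"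
        using P by simp_all
      show "set (P i j) \<subseteq> V"
        using P S_V[OF ij(1,2)] by auto
      have "P i j \<noteq> []"
        using P by (simp add: graph_path_def)
      then have "b i \<in> set (P i j)" "b j \<in> set (P i j)"
        using P hd_in_set[of "P i j"] last_in_set[of "P i j"] by simp_all
      moreover have "S i j \<inter> b ` {..<t} \<subseteq> {b i, b j}"
        using S_sub[of i j] B_b[OF ij(1,2)] B_b[OF ij(2,1)] by blast
      ultimately show "set (P i j) \<inter> b ` {..<t} = {b i, b j}"
        using P ij(1,2) by auto
    }
    fix k l
    assume "i < j \<and> j < t \<and> k < l \<and> l < t \<and> (i, j) \<noteq> (k, l)"
    then have ij: "i < t" "j < t" "i \<noteq> j" and kl: "k < t" "l < t" "k \<noteq> l"
      and ne: "(i, j) \<noteq> (k, l)" "(i, j) \<noteq> (l, k)" "(j, i) \<noteq> (k, l)" "(j, i) \<noteq> (l, k)"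
      by auto
    note disj = config_memD(5)[OF conf mem mem]
    have "(B (i, j) \<union> B (j, i)) \<inter> (B (k, l) \<union> B (l, k)) = {}"
      unfolding Int_Un_distrib Int_Un_distrib2
      using disj[OF ij(1,2) kl(1,2) ne(1)] disj[OF ij(1,2) kl(2,1) ne(2)]
        disj[OF ij(2,1) kl(1,2) ne(3)] disj[OF ij(2,1) kl(2,1) ne(4)]
      by simp
    moreover have "{b i, b j} \<subseteq> b ` {..<t}" "{b k, b l} \<subseteq> b ` {..<t}"
      using ij kl by simp_all
    moreover have "({u, u'} \<union> M) \<inter> ({w, w'} \<union> M') \<subseteq> D"
      if "M \<inter> M' = {}" "{u, u'} \<subseteq> D" "{w, w'} \<subseteq> D" for u u' w w' :: 'a and M M' D
      using that by blast
    ultimately have "({b i, b j} \<union> (B (i, j) \<union> B (j, i))) \<inter> ({b k, b l} \<union> (B (k, l) \<union> B (l, k))) \<subseteq> b ` {..<t}"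
      by simp
    moreover have "set (P i j) \<subseteq> {b i, b j} \<union> (B (i, j) \<union> B (j, i))"
      using P[OF ij] order_trans[OF _ S_sub[of i j]] by blast
    moreover have "set (P k l) \<subseteq> {b k, b l} \<union> (B (k, l) \<union> B (l, k))"
      using P[OF kl] order_trans[OF _ S_sub[of k l]] by blast
    ultimately show "set (P i j) \<inter> set (P k l) \<subseteq> b ` {..<t}"
      by (meson Int_mono order_trans)
  qed
qed

end

theorem theorem1:
  fixes V :: "'a set" and E :: "'a \<Rightarrow> 'a \<Rightarrow> bool"
  assumes "simple_graph V E" and "countable V"
    and "\<forall>(W :: nat set) (F :: nat \<Rightarrow> nat \<Rightarrow> bool).
           simple_graph W F \<and> planar W F \<longrightarrow> graph_contains V E W F"
  shows "has_K_aleph0_minor V E \<and> (\<forall>t. has_subdivided_K V E t)"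
proof -
  have lattice: "\<exists>A f. embedded_lattice V E t A f" for t
  proof (rule accumulating_embedding[OF assms, of t])
    fix A f
    assume *: "inj f" "range f \<subseteq> V" "\<And>p q. adj t A p q \<Longrightarrow> E (f p) (f q)"
      "\<And>n Z. finite Z \<Longrightarrow> \<exists>B g. B \<noteq> A \<and> (\<forall>x\<le>n. B x = A x) \<and> inj g \<and> range g \<subseteq> V \<and>
         (\<forall>p q. adj t B p q \<longrightarrow> E (g p) (g q)) \<and>
         (\<forall>x\<le>n. \<forall>y\<le>n. g (x, y) = f (x, y)) \<and> range g \<inter> Z \<subseteq> range f"
    have "embedded_lattice V E t A f"
    proof
      show "E y x" if "E x y" for x y
        using assms(1) that by (simp add: simple_graph_def)
    qed (fact *)+
    then show "\<exists>A f. embedded_lattice V E t A f"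
      by (intro exI)
  qed
  show ?thesis
  proof (intro conjI allI)
    obtain A f where "embedded_lattice V E 0 A f"
      using lattice[of 0] by blast
    then show "has_K_aleph0_minor V E"
      by (rule embedded_lattice.K_aleph0_minor)
  next
    fix t
    obtain A f where "embedded_lattice V E t A f"
      using lattice[of t] by blast
    then show "has_subdivided_K V E t"
      by (rule embedded_lattice.subdivided_K)
  qed
qed

end
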